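(* For all $e^j=(I^j,H^j,V^j,E^j)\in\operatorname{dom}\overline{\mathfrak J}$, $j=1,2$, $$\langle\overline{\mathfrak J}e^1,e^2\rangle_{\mathcal X}+\langle e^1,\overline{\mathfrak J}e^2\rangle_{\mathcal X}=\Big\langle\hat{\mathfrak B}_1\binom{I^1}{H^1},\hat{\mathfrak B}_2\binom{V^2}{E^2}\Big\rangle_{\mathbb{C}^{2k}}+\Big\langle\hat{\mathfrak B}_2\binom{V^1}{E^1},\hat{\mathfrak B}_1\binom{I^2}{H^2}\Big\rangle_{\mathbb{C}^{2k}},$$ which for $(I^j,H^j)\in\operatorname{dom}A_1$ reads $\langle (I^1_{\mathrm{tot}}(0),I^1_{\mathrm{tot}}(1)),(V^2(0),-V^2(1))\rangle+\langle (V^1(0),-V^1(1)),(I^2_{\mathrm{tot}}(0),I^2_{\mathrm{tot}}(1))\rangle$.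
   Context: Standing setting. Let $k\in\mathbb{N}$ and let $\Omega_0\subseteq\mathbb{R}^3$ be a (possibly unbounded) Lipschitz domain. For $i=1,\dots,k$ let $r_i,l_i>0$, let $\alpha_i\in C^2([0,1];\mathbb{R}^3)$ with $\|\alpha_i'(\eta)\|=l_i$ and $\|\alpha_i''(\eta)\|<l_i^2/r_i$ for all $\eta\in[0,1]$, and let $\kappa_{i1},\kappa_{i2}\in C^1([0,1];\mathbb{R}^3)$ be such that $(l_i^{-1}\alpha_i'(\eta),\kappa_{i1}(\eta),\kappa_{i2}(\eta))$ is a positively oriented orthonormal basis of $\mathbb{R}^3$ for every $\eta$. Put $\beta_{i\eta}(\theta)=r_i(\kappa_{i1}(\eta)\sin\theta+\kappa_{i2}(\eta)\cos\theta)$ and $\Omega_i=\{\alpha_i(\eta)+\delta\beta_{i\eta}(\theta):\delta,\eta\in[0,1],\theta\in(-\pi,\pi]\}$. Assume $\overline{\Omega_i}\subseteq\Omega_0$ and $\overline{\Omega_i}\cap\overline{\Omega_j}=\emptyset$ for $i\neq j$, and let $\Omega=\Omega_0\setminus\bigcup_{i=1}^k\overline{\Omega_i}$ with outward unit normal $\nu$ (defined a.e. on $\partial\Omega$). Let $\Phi_i(\eta,\theta)=\alpha_i(\eta)+\beta_{i\eta}(\theta)$; the lateral surface $\Gamma_{i,\mathrm{lat}}=\Phi_i((0,1)\times(-\pi,\pi])$ is parametrized (essentially injectively) by $\Phi_i$, and $\Psi_i=(\Psi_{i1},\Psi_{i2})\colon\Gamma_{i,\mathrm{lat}}\to[0,1]\times(-\pi,\pi]$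 denotes the inverse. The end faces are $\Gamma_{i,\mathrm{end}}=\{\alpha_i(\eta)+\delta\beta_{i\eta}(\theta):\eta\in\{0,1\},\delta\in[0,1),\theta\in(-\pi,\pi]\}$. Set $\Gamma_{\mathrm{lat}}=\bigcup_i\Gamma_{i,\mathrm{lat}}$ and $\Gamma_{\mathrm r}=\partial\Omega_0\cup\bigcup_i\Gamma_{i,\mathrm{end}}$. Function spaces and traces. Inner products are linear in the first and antilinear in the second argument. $C^\infty(\overline\Omega;\mathbb{C}^3)$ is the set of restrictions to $\Omega$ of functions in $C_c^\infty(\mathbb{R}^3;\mathbb{C}^3)$; $C^\infty_{\Gamma_{\mathrm r}}(\Omega;\mathbb{C}^3)$ is the set of $f\in C^\infty(\overline\Omega;\mathbb{C}^3)$ with $\operatorname{supp}f\cap\overline{\Gamma_{\mathrm r}}=\emptyset$. $H(\mathrm{rot},\Omega)=\{E\in L^2(\Omega;\mathbb{C}^3):\mathrm{rot}E\in L^2(\Omega;\mathbb{C}^3)\}$ with norm $(\|E\|_{L^2}^2+\|\mathrm{rot}E\|_{L^2}^2)^{1/2}$, and $H_{\Gamma_{\mathrm r}}(\mathrm{rot},\Omega)$ is the closure of $C^\infty_{\Gamma_{\mathrm r}}(\Omega;\mathbb{C}^3)$ in $H(\mathrm{rot},\Omega)$. For $H\in C^\infty(\overline\Omega;\mathbb{C}^3)$ put $\gamma_\times H=\nu\times H|_{\partial\Omega}$. For $E\in H_{\Gamma_{\mathrm r}}(\mathrm{rot},\Omega)$ and $f\in L^2(\Gamma_{\mathrm{lat}};\mathbb{C}^3)$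 we write "$\gamma_\tau E=f$ on $\Gamma_{\mathrm{lat}}$" if $\langle E,\mathrm{rot}H\rangle_{L^2(\Omega)}-\langle\mathrm{rot}E,H\rangle_{L^2(\Omega)}=\langle f,\gamma_\times H\rangle_{L^2(\Gamma_{\mathrm{lat}})}$ for all $H\in C^\infty(\overline\Omega;\mathbb{C}^3)$ (for smooth $E$ this means $(\nu\times E)\times\nu=f$ on $\Gamma_{\mathrm{lat}}$). Port operator. Let $\nabla\Phi_i(\eta,\theta)\in\mathbb{R}^{2\times3}$ be the transpose of the Jacobian of $\Phi_i$ and $(\cdot)^\dagger$ the Moore–Penrose inverse. Define $P_{i,\mathrm{el}}\colon L^2((0,1);\mathbb{C})\to L^2(\Gamma_{i,\mathrm{lat}};\mathbb{C}^3)$, $P_{i,\mathrm{el}}f=(\nabla\Phi_i\circ\Psi_i)^\dagger\binom{f\circ\Psi_{i1}}{0}$, and $P_{\mathrm{el}}\colon L^2((0,1);\mathbb{C}^k)\to L^2(\Gamma_{\mathrm{lat}};\mathbb{C}^3)$ by $(P_{\mathrm{el}}f)|_{\Gamma_{i,\mathrm{lat}}}=P_{i,\mathrm{el}}f_i$; it is bounded and $P_{\mathrm{el}}^*$ denotes its Hilbert-space adjoint. Operators. Let $\mathcal X_1=L^2((0,1);\mathbb{C}^k)\times L^2(\Omega;\mathbb{C}^3)$; $\frac{d}{d\eta}$ is the weak derivative. Define $A_1\binom IH=\binom{-\frac{d}{d\eta}I+\frac{d}{d\eta}(P_{\mathrm{el}}^*\gamma_\times H)}{\mathrm{rot}H}$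 on $\operatorname{dom}A_1=H^1((0,1);\mathbb{C}^k)\times C^\infty(\overline\Omega;\mathbb{C}^3)$; $A_2\binom VE=\binom{-\frac{d}{d\eta}V}{-\mathrm{rot}E}$ on $\operatorname{dom}A_2=\{(V,E)\in H^1((0,1);\mathbb{C}^k)\times H_{\Gamma_{\mathrm r}}(\mathrm{rot},\Omega):\gamma_\tau E=P_{\mathrm{el}}\tfrac{d}{d\eta}V\text{ on }\Gamma_{\mathrm{lat}}\}$. $A_2$ is closed and $A_1$ is closable with closure $\overline{A_1}$. Let $\mathcal X=\mathcal X_1\times\mathcal X_1=L^2((0,1);\mathbb{C}^k)\times L^2(\Omega;\mathbb{C}^3)\times L^2((0,1);\mathbb{C}^k)\times L^2(\Omega;\mathbb{C}^3)$ with elements written $e=(I,H,V,E)$, and $\mathfrak J e=\big(A_2(V,E),A_1(I,H)\big)$ on $\operatorname{dom}\mathfrak J=\operatorname{dom}A_1\times\operatorname{dom}A_2$. Its closure is $\overline{\mathfrak J}e=\big(A_2(V,E),\overline{A_1}(I,H)\big)$ on $\operatorname{dom}\overline{\mathfrak J}=\operatorname{dom}\overline{A_1}\times\operatorname{dom}A_2$. Boundary maps. For $(I,H)\in\operatorname{dom}A_1$ let $I_{\mathrm{tot}}=I-P_{\mathrm{el}}^*\gamma_\times H$ and $\hat{\mathfrak B}_1(I,H)=(I_{\mathrm{tot}}(0),I_{\mathrm{tot}}(1))\in\mathbb{C}^{2k}$; for $(V,E)\in\operatorname{dom}A_2$ let $\hat{\mathfrak B}_2(V,E)=(V(0),-V(1))\in\mathbb{C}^{2k}$.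 The map $\hat{\mathfrak B}_1$ is continuous with respect to the graph norm of $A_1$ and is extended uniquely by continuity to $\operatorname{dom}\overline{A_1}$; the extension is still denoted $\hat{\mathfrak B}_1$. *)

theory Defs
  imports "HOL-Analysis.Analysis"
begin

type_synonym pt = "real^3"
type_synonym cvec = "complex^3"

definition cdot :: "complex^'n \<Rightarrow> complex^'n \<Rightarrow> complex" where
  "cdot u v = (\<Sum>j\<in>UNIV. u $ j * cnj (v $ j))"

definition L2 :: "'a measure \<Rightarrow> ('a \<Rightarrow> complex^'n) \<Rightarrow> bool" where
  "L2 M f \<longleftrightarrow> f \<in> borel_measurable M \<and> integrable M (\<lambda>x. (norm (f x))\<^sup>2)"

definition ipL2 :: "'a measure \<Rightarrow> ('a \<Rightarrow> complex^'n) \<Rightarrow> ('a \<Rightarrow> complex^'n) \<Rightarrow> complex" where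
  "ipL2 M f g = integral\<^sup>L M (\<lambda>x. cdot (f x) (g x))"

definition L2conv :: "'a measure \<Rightarrow> (nat \<Rightarrow> 'a \<Rightarrow> complex^'n) \<Rightarrow> ('a \<Rightarrow> complex^'n) \<Rightarrow> bool" where
  "L2conv M fs f \<longleftrightarrow> (\<lambda>n. integral\<^sup>L M (\<lambda>x. (norm (fs n x - f x))\<^sup>2)) \<longlonglongrightarrow> 0"

abbreviation I01 :: "real measure" where "I01 \<equiv> lebesgue_on {0..1}"

definition test01 :: "(real \<Rightarrow> real) \<Rightarrow> bool" where
  "test01 \<phi> \<longleftrightarrow> (\<forall>n x. ((deriv ^^ n) \<phi>) differentiable (at x)) \<and>
                  closure {t. \<phi> t \<noteq> 0} \<subseteq> {0<..<1}"

definition wder :: "(real \<Rightarrow> complex^'n) \<Rightarrow> (real \<Rightarrow> complex^'n) \<Rightarrow> bool" where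
  "wder u w \<longleftrightarrow> (\<forall>\<phi>. test01 \<phi> \<longrightarrow>
     integral\<^sup>L I01 (\<lambda>t. deriv \<phi> t *\<^sub>R u t) = - integral\<^sup>L I01 (\<lambda>t. \<phi> t *\<^sub>R w t))"

definition H1 :: "(real \<Rightarrow> complex^'n) \<Rightarrow> bool" where
  "H1 u \<longleftrightarrow> L2 I01 u \<and> (\<exists>w. L2 I01 w \<and> wder u w)"

text \<open>Value at t of the continuous representative (well defined for H1 functions).\<close>
definition ev :: "(real \<Rightarrow> complex^'n) \<Rightarrow> real \<Rightarrow> complex^'n" where
  "ev u t = (THE c. \<exists>v. continuous_on {0..1} v \<and> (AE s in I01. u s = v s) \<and> v t = c)"

definition pd :: "3 \<Rightarrow> (pt \<Rightarrow> cvec) \<Rightarrow> pt \<Rightarrow> cvec" where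
  "pd j f x = frechet_derivative f (at x) (axis j 1)"

fun dpart :: "3 list \<Rightarrow> (pt \<Rightarrow> cvec) \<Rightarrow> pt \<Rightarrow> cvec" where
  "dpart [] f = f"
| "dpart (j # js) f = pd j (dpart js f)"

definition Cinf :: "(pt \<Rightarrow> cvec) \<Rightarrow> bool" where
  "Cinf f \<longleftrightarrow> (\<forall>js x. dpart js f differentiable (at x))"

text \<open>C_c^infinity(R^3;C^3); C^infinity(closure Omega;C^3) consists of restrictions of these.\<close>
definition Cc_inf :: "(pt \<Rightarrow> cvec) \<Rightarrow> bool" where
  "Cc_inf f \<longleftrightarrow> Cinf f \<and> compact (closure {x. f x \<noteq> 0})"

definition rotc :: "(pt \<Rightarrow> cvec) \<Rightarrow> pt \<Rightarrow> cvec" where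
  "rotc f x = (\<chi> j. if j = 1 then pd 2 f x $ 3 - pd 3 f x $ 2
                else if j = 2 then pd 3 f x $ 1 - pd 1 f x $ 3
                else pd 1 f x $ 2 - pd 2 f x $ 1)"

definition wrot :: "pt set \<Rightarrow> (pt \<Rightarrow> cvec) \<Rightarrow> (pt \<Rightarrow> cvec) \<Rightarrow> bool" where
  "wrot \<Omega> E F \<longleftrightarrow> (\<forall>\<phi>. Cc_inf \<phi> \<and> closure {x. \<phi> x \<noteq> 0} \<subseteq> \<Omega> \<longrightarrow>
      ipL2 (lebesgue_on \<Omega>) E (rotc \<phi>) = ipL2 (lebesgue_on \<Omega>) F \<phi>)"

definition ccross :: "cvec \<Rightarrow> cvec \<Rightarrow> cvec" where
  "ccross a b = (\<chi> j. if j = 1 then a$2 * b$3 - a$3 * b$2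
                  else if j = 2 then a$3 * b$1 - a$1 * b$3
                  else a$1 * b$2 - a$2 * b$1)"

definition cvec_of :: "pt \<Rightarrow> cvec" where
  "cvec_of v = (\<chi> j. complex_of_real (v $ j))"

definition pinv :: "real^3^2 \<Rightarrow> real^2^3" where
  "pinv M = (THE X. M ** X ** M = M \<and> X ** M ** X = X \<and>
                    transpose (M ** X) = M ** X \<and> transpose (X ** M) = X ** M)"

definition lipschitz_domain :: "pt set \<Rightarrow> bool" where
  "lipschitz_domain U \<longleftrightarrow> open U \<and> connected U \<and> U \<noteq> {} \<and>
    (\<forall>x\<in>frontier U. \<exists>Q::real^3^3. \<exists>\<rho>>0. \<exists>g::real\<times>real\<Rightarrow>real. \<exists>L.
       orthogonal_matrix Q \<and> (\<forall>a b. \<bar>g a - g b\<bar> \<le> L * dist a b) \<and>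
       U \<inter> ball x \<rho> = {y \<in> ball x \<rho>. (Q *v (y - x)) $ 3 <
            g ((Q *v (y - x)) $ 1, (Q *v (y - x)) $ 2)})"

definition vd :: "(real \<Rightarrow> pt) \<Rightarrow> real \<Rightarrow> pt" where
  "vd f \<eta> = vector_derivative f (at \<eta> within {0..1})"

definition C1_01 :: "(real \<Rightarrow> pt) \<Rightarrow> bool" where
  "C1_01 f \<longleftrightarrow> (\<forall>\<eta>\<in>{0..1}. f differentiable (at \<eta> within {0..1})) \<and> continuous_on {0..1} (vd f)"

definition C2_01 :: "(real \<Rightarrow> pt) \<Rightarrow> bool" where
  "C2_01 f \<longleftrightarrow> (\<forall>\<eta>\<in>{0..1}. f differentiable (at \<eta> within {0..1})) \<and> C1_01 (vd f)"

definition pos_onb :: "pt \<Rightarrow> pt \<Rightarrow> pt \<Rightarrow> bool" where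
  "pos_onb a b c \<longleftrightarrow> norm a = 1 \<and> norm b = 1 \<and> norm c = 1 \<and>
     a \<bullet> b = 0 \<and> a \<bullet> c = 0 \<and> b \<bullet> c = 0 \<and>
     det (\<chi> j. if j = 1 then a else if j = 2 then b else c :: real^3^3) > 0"

definition beta :: "('k \<Rightarrow> real) \<Rightarrow> ('k \<Rightarrow> real \<Rightarrow> pt) \<Rightarrow> ('k \<Rightarrow> real \<Rightarrow> pt) \<Rightarrow> 'k \<Rightarrow> real \<Rightarrow> real \<Rightarrow> pt" where
  "beta r \<kappa>1 \<kappa>2 i \<eta> \<theta> = r i *\<^sub>R (sin \<theta> *\<^sub>R \<kappa>1 i \<eta> + cos \<theta> *\<^sub>R \<kappa>2 i \<eta>)"

definition Phi :: "('k \<Rightarrow> real) \<Rightarrow> ('k \<Rightarrow> real \<Rightarrow> pt) \<Rightarrow> ('k \<Rightarrow> real \<Rightarrow> pt) \<Rightarrow> ('k \<Rightarrow> real \<Rightarrow> pt)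
    \<Rightarrow> 'k \<Rightarrow> real \<Rightarrow> real \<Rightarrow> pt" where
  "Phi r \<alpha> \<kappa>1 \<kappa>2 i \<eta> \<theta> = \<alpha> i \<eta> + beta r \<kappa>1 \<kappa>2 i \<eta> \<theta>"

definition tube :: "('k \<Rightarrow> real) \<Rightarrow> ('k \<Rightarrow> real \<Rightarrow> pt) \<Rightarrow> ('k \<Rightarrow> real \<Rightarrow> pt) \<Rightarrow> ('k \<Rightarrow> real \<Rightarrow> pt)
    \<Rightarrow> 'k \<Rightarrow> pt set" where
  "tube r \<alpha> \<kappa>1 \<kappa>2 i = {\<alpha> i \<eta> + \<delta> *\<^sub>R beta r \<kappa>1 \<kappa>2 i \<eta> \<theta> | \<delta> \<eta> \<theta>.
        \<delta> \<in> {0..1} \<and> \<eta> \<in> {0..1} \<and> \<theta> \<in> {-pi<..pi}}"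

definition Gamma_end :: "('k \<Rightarrow> real) \<Rightarrow> ('k \<Rightarrow> real \<Rightarrow> pt) \<Rightarrow> ('k \<Rightarrow> real \<Rightarrow> pt) \<Rightarrow> ('k \<Rightarrow> real \<Rightarrow> pt)
    \<Rightarrow> 'k \<Rightarrow> pt set" where
  "Gamma_end r \<alpha> \<kappa>1 \<kappa>2 i = {\<alpha> i \<eta> + \<delta> *\<^sub>R beta r \<kappa>1 \<kappa>2 i \<eta> \<theta> | \<delta> \<eta> \<theta>.
        \<delta> \<in> {0..<1} \<and> \<eta> \<in> {0,1} \<and> \<theta> \<in> {-pi<..pi}}"

definition Omega :: "pt set \<Rightarrow> ('k \<Rightarrow> real) \<Rightarrow> ('k \<Rightarrow> real \<Rightarrow> pt) \<Rightarrow> ('k \<Rightarrow> real \<Rightarrow> pt) \<Rightarrow> ('k \<Rightarrow> real \<Rightarrow> pt)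
    \<Rightarrow> pt set" where
  "Omega \<Omega>0 r \<alpha> \<kappa>1 \<kappa>2 = \<Omega>0 - (\<Union>i. closure (tube r \<alpha> \<kappa>1 \<kappa>2 i))"

definition Gamma_r :: "pt set \<Rightarrow> ('k \<Rightarrow> real) \<Rightarrow> ('k \<Rightarrow> real \<Rightarrow> pt) \<Rightarrow> ('k \<Rightarrow> real \<Rightarrow> pt) \<Rightarrow> ('k \<Rightarrow> real \<Rightarrow> pt)
    \<Rightarrow> pt set" where
  "Gamma_r \<Omega>0 r \<alpha> \<kappa>1 \<kappa>2 = frontier \<Omega>0 \<union> (\<Union>i. Gamma_end r \<alpha> \<kappa>1 \<kappa>2 i)"

definition dPhi_eta where
  "dPhi_eta r \<alpha> \<kappa>1 \<kappa>2 i \<eta> \<theta> = vector_derivative (\<lambda>s. Phi r \<alpha> \<kappa>1 \<kappa>2 i s \<theta>) (at \<eta> within {0..1})"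

definition dPhi_theta where
  "dPhi_theta r \<alpha> \<kappa>1 \<kappa>2 i \<eta> \<theta> = vector_derivative (\<lambda>s. Phi r \<alpha> \<kappa>1 \<kappa>2 i \<eta> s) (at \<theta>)"

definition gradPhi :: "('k \<Rightarrow> real) \<Rightarrow> ('k \<Rightarrow> real \<Rightarrow> pt) \<Rightarrow> ('k \<Rightarrow> real \<Rightarrow> pt) \<Rightarrow> ('k \<Rightarrow> real \<Rightarrow> pt)
    \<Rightarrow> 'k \<Rightarrow> real \<Rightarrow> real \<Rightarrow> real^3^2" where
  "gradPhi r \<alpha> \<kappa>1 \<kappa>2 i \<eta> \<theta> = (\<chi> a. if a = 1 then dPhi_eta r \<alpha> \<kappa>1 \<kappa>2 i \<eta> \<theta>
                                     else dPhi_theta r \<alpha> \<kappa>1 \<kappa>2 i \<eta> \<theta>)"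

definition area where
  "area r \<alpha> \<kappa>1 \<kappa>2 i \<eta> \<theta> = norm (cross3 (dPhi_eta r \<alpha> \<kappa>1 \<kappa>2 i \<eta> \<theta>) (dPhi_theta r \<alpha> \<kappa>1 \<kappa>2 i \<eta> \<theta>))"

text \<open>Outward unit normal of Omega at the point Phi_i(eta,theta) of the lateral surface
  (pointing into the wire).\<close>
definition nu :: "('k \<Rightarrow> real) \<Rightarrow> ('k \<Rightarrow> real \<Rightarrow> pt) \<Rightarrow> ('k \<Rightarrow> real \<Rightarrow> pt) \<Rightarrow> 'k \<Rightarrow> real \<Rightarrow> real \<Rightarrow> pt" where
  "nu r \<kappa>1 \<kappa>2 i \<eta> \<theta> = - (1 / r i) *\<^sub>R beta r \<kappa>1 \<kappa>2 i \<eta> \<theta>"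

text \<open>Fields on Gamma_lat are represented through the parametrisation:
  F i eta theta is the value at Phi_i(eta,theta).  L2(Gamma_lat) inner product via the
  surface measure |d_eta Phi x d_theta Phi| d eta d theta.\<close>
definition spair where
  "spair r \<alpha> \<kappa>1 \<kappa>2 (F :: 'k \<Rightarrow> real \<Rightarrow> real \<Rightarrow> cvec) G =
     (\<Sum>i\<in>UNIV. integral\<^sup>L (lebesgue_on ({0..1} \<times> {-pi<..pi}))
        (\<lambda>(\<eta>,\<theta>). cdot (F i \<eta> \<theta>) (G i \<eta> \<theta>) * complex_of_real (area r \<alpha> \<kappa>1 \<kappa>2 i \<eta> \<theta>)))"

definition gx where
  "gx r \<alpha> \<kappa>1 \<kappa>2 (H :: pt \<Rightarrow> cvec) i \<eta> \<theta> =
     ccross (cvec_of (nu r \<kappa>1 \<kappa>2 i \<eta> \<theta>)) (H (Phi r \<alpha> \<kappa>1 \<kappa>2 i \<eta> \<theta>))"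

text \<open>Port operator P_el f = (grad Phi o Psi)^dagger (f_i o Psi_i1, 0).\<close>
definition Pel where
  "Pel r \<alpha> \<kappa>1 \<kappa>2 (f :: real \<Rightarrow> complex^'k) i \<eta> \<theta> =
     (\<chi> j. complex_of_real (pinv (gradPhi r \<alpha> \<kappa>1 \<kappa>2 i \<eta> \<theta>) $ j $ 1) * (f \<eta> $ i))"

definition is_Padj where
  "is_Padj r \<alpha> \<kappa>1 \<kappa>2 (w :: real \<Rightarrow> complex^'k) g \<longleftrightarrow> L2 I01 w \<and>
     (\<forall>h. L2 I01 h \<longrightarrow> ipL2 I01 w h = spair r \<alpha> \<kappa>1 \<kappa>2 g (Pel r \<alpha> \<kappa>1 \<kappa>2 h))"

text \<open>Graph of A_1 together with the boundary map B_1: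
  A1B ... (I,H) (Y,Z) b  means (I,H) in dom A_1, A_1(I,H) = (Y,Z), B_1(I,H) = b.\<close>
definition A1B where
  "A1B \<Omega>0 r \<alpha> \<kappa>1 \<kappa>2 (IH :: (real \<Rightarrow> complex^'k) \<times> (pt \<Rightarrow> cvec)) YZ b \<longleftrightarrow>
     (let I = fst IH; H = snd IH; Y = fst YZ; Z = snd YZ in
      H1 I \<and> Cc_inf H \<and>
      (\<exists>w. is_Padj r \<alpha> \<kappa>1 \<kappa>2 w (gx r \<alpha> \<kappa>1 \<kappa>2 H) \<and> L2 I01 Y \<and>
           wder (\<lambda>t. w t - I t) Y \<and>
           b = (ev (\<lambda>t. I t - w t) 0, ev (\<lambda>t. I t - w t) 1)) \<and>
      (\<forall>x. Z x = rotc H x))"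

text \<open>Graph of the closure of A_1 together with the continuous extension of B_1.\<close>
definition A1barB where
  "A1barB \<Omega>0 r \<alpha> \<kappa>1 \<kappa>2 (IH :: (real \<Rightarrow> complex^'k) \<times> (pt \<Rightarrow> cvec)) YZ b \<longleftrightarrow>
     (let \<Omega> = Omega \<Omega>0 r \<alpha> \<kappa>1 \<kappa>2 in
      L2 I01 (fst IH) \<and> L2 (lebesgue_on \<Omega>) (snd IH) \<and>
      L2 I01 (fst YZ) \<and> L2 (lebesgue_on \<Omega>) (snd YZ) \<and>
      (\<exists>IHs YZs bs. (\<forall>n. A1B \<Omega>0 r \<alpha> \<kappa>1 \<kappa>2 (IHs n) (YZs n) (bs n)) \<and>
          L2conv I01 (\<lambda>n. fst (IHs n)) (fst IH) \<and>
          L2conv (lebesgue_on \<Omega>) (\<lambda>n. snd (IHs n)) (snd IH) \<and>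
          L2conv I01 (\<lambda>n. fst (YZs n)) (fst YZ) \<and>
          L2conv (lebesgue_on \<Omega>) (\<lambda>n. snd (YZs n)) (snd YZ) \<and>
          bs \<longlonglongrightarrow> b))"

definition Cinf_Gr where
  "Cinf_Gr \<Omega>0 r \<alpha> \<kappa>1 \<kappa>2 (f :: pt \<Rightarrow> cvec) \<longleftrightarrow> Cc_inf f \<and>
     closure {x \<in> Omega \<Omega>0 r \<alpha> \<kappa>1 \<kappa>2. f x \<noteq> 0} \<inter> closure (Gamma_r \<Omega>0 r \<alpha> \<kappa>1 \<kappa>2) = {}"

definition HGr where
  "HGr \<Omega>0 r \<alpha> \<kappa>1 \<kappa>2 (E :: pt \<Rightarrow> cvec) F \<longleftrightarrow>
     (let \<Omega> = Omega \<Omega>0 r \<alpha> \<kappa>1 \<kappa>2 in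
      L2 (lebesgue_on \<Omega>) E \<and> L2 (lebesgue_on \<Omega>) F \<and> wrot \<Omega> E F \<and>
      (\<exists>fs. (\<forall>n. Cinf_Gr \<Omega>0 r \<alpha> \<kappa>1 \<kappa>2 (fs n)) \<and> L2conv (lebesgue_on \<Omega>) fs E \<and>
            L2conv (lebesgue_on \<Omega>) (\<lambda>n. rotc (fs n)) F))"

text \<open>Graph of A_2: A2 ... (V,E) (Y,Z) means (V,E) in dom A_2 and A_2(V,E) = (Y,Z).\<close>
definition A2 where
  "A2 \<Omega>0 r \<alpha> \<kappa>1 \<kappa>2 (VE :: (real \<Rightarrow> complex^'k) \<times> (pt \<Rightarrow> cvec)) YZ \<longleftrightarrow>
     (let \<Omega> = Omega \<Omega>0 r \<alpha> \<kappa>1 \<kappa>2; V = fst VE; E = snd VE in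
      \<exists>V' F. L2 I01 V \<and> L2 I01 V' \<and> wder V V' \<and> HGr \<Omega>0 r \<alpha> \<kappa>1 \<kappa>2 E F \<and>
        (\<forall>H. Cc_inf H \<longrightarrow>
           ipL2 (lebesgue_on \<Omega>) E (rotc H) - ipL2 (lebesgue_on \<Omega>) F H =
           spair r \<alpha> \<kappa>1 \<kappa>2 (Pel r \<alpha> \<kappa>1 \<kappa>2 V') (gx r \<alpha> \<kappa>1 \<kappa>2 H)) \<and>
        fst YZ = (\<lambda>t. - V' t) \<and> snd YZ = (\<lambda>x. - F x))"

definition B2 :: "(real \<Rightarrow> complex^'k) \<Rightarrow> (complex^'k) \<times> (complex^'k)" where
  "B2 V = (ev V 0, - ev V 1)"

definition ipX1 where
  "ipX1 \<Omega> (a :: (real \<Rightarrow> complex^'k) \<times> (pt \<Rightarrow> cvec)) b =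
     ipL2 I01 (fst a) (fst b) + ipL2 (lebesgue_on \<Omega>) (snd a) (snd b)"

definition ip2k :: "(complex^'k) \<times> (complex^'k) \<Rightarrow> (complex^'k) \<times> (complex^'k) \<Rightarrow> complex" where
  "ip2k a b = cdot (fst a) (fst b) + cdot (snd a) (snd b)"

end

theory Submission
  imports Defs
begin

text \<open>Fix \<open>(I, H)\<close> in the domain of \<open>A\<^sub>1\<close> and \<open>(V, E)\<close> in the domain of \<open>A\<^sub>2\<close>. The boundary
  condition on \<open>E\<close>, tested with \<open>H\<close>, moves the curl from \<open>H\<close> to \<open>E\<close> at the price of the surface
  pairing of \<open>\<gamma>\<^sub>\<times> H\<close> with \<open>P\<^sub>e\<^sub>l V'\<close>, which is the \<open>L\<^sup>2\<close> pairing of \<open>P\<^sub>e\<^sub>l\<^sup>* \<gamma>\<^sub>\<times> H\<close> with \<open>V'\<close>. What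
  remains is one-dimensional integration by parts for \<open>I\<^sub>t\<^sub>o\<^sub>t = I - P\<^sub>e\<^sub>l\<^sup>* \<gamma>\<^sub>\<times> H\<close> against \<open>V\<close>, whose
  boundary terms are the port variables. The identity passes to the closure of \<open>A\<^sub>1\<close> because all
  terms are continuous for \<open>L\<^sup>2\<close> convergence; adding its complex conjugate with the roles of the two
  elements exchanged yields the theorem.

  Integration by parts under the weak derivative rests on the du Bois-Reymond lemma. Its test
  functions are built from the flat function \<open>exp (- 1 / x)\<close>: the products
  \<open>flat 1 (n t - n a - 1) * flat 1 (n - 1 - n t)\<close> are bounded by 1 and converge to the indicator of \<open>(a, 1)\<close>.\<close>

subsection \<open>Test functions\<close>

text \<open>The polynomial is a parameter because differentiating \<open>exp (- 1 / x)\<close> only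
  produces polynomial factors in \<open>1 / x\<close>: one derivative rule for the whole family then
  gives smoothness of all orders.\<close>

definition flat :: "real poly \<Rightarrow> real \<Rightarrow> real" where
  "flat p x = (if x > 0 then poly p (inverse x) * exp (- inverse x) else 0)"

text \<open>Exponential decay beats every polynomial; with \<open>y = 1 / h\<close> this controls
  \<open>flat\<close> at the origin. The factor \<open>y ^ k\<close> strengthens the induction on
  \<open>p\<close>: splitting off the constant coefficient raises \<open>k\<close> by one.\<close>

lemma poly_times_exp_neg_tendsto_0:
  "((\<lambda>y::real. y ^ k * poly p y * exp (- y)) \<longlongrightarrow> 0) at_top"
proof (induction p arbitrary: k)
  case 0
  then show ?case by simp
next
  case (pCons a p)
  have "((\<lambda>y::real. a * (y ^ k / exp y) + y ^ Suc k * poly p y * exp (- y)) \<longlongrightarrow> a * 0 + 0) at_top"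
    by (intro tendsto_intros tendsto_power_div_exp_0 pCons.IH)
  moreover have "(\<lambda>y::real. a * (y ^ k / exp y) + y ^ Suc k * poly p y * exp (- y))
      = (\<lambda>y. y ^ k * poly (pCons a p) y * exp (- y))"
    by (auto simp: exp_minus field_simps)
  ultimately show ?case by simp
qed

text \<open>For positive \<open>x\<close>, differentiating \<open>p(1/x) exp(-1/x)\<close> gives
  \<open>x^(-2) (p - p')(1/x) exp(-1/x)\<close>, hence the polynomial \<open>y^2 (p - p')\<close>.
  Only the origin needs a limit.\<close>

lemma flat_has_derivative:
  "(flat p has_real_derivative flat (monom 1 2 * (p - pderiv p)) x) (at x)"
proof -
  consider "x > 0" | "x < 0" | "x = 0" by linarith
  then show ?thesis
  proof cases
    case 1
    have "((\<lambda>x. poly p (inverse x) * exp (- inverse x)) has_real_derivative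
        flat (monom 1 2 * (p - pderiv p)) x) (at x)"
      using 1 by (auto intro!: derivative_eq_intros simp: flat_def poly_monom algebra_simps power2_eq_square)
    then show ?thesis
      by (rule has_field_derivative_transform_within_open[where S="{0<..}"])
        (use 1 in \<open>auto simp: flat_def\<close>)
  next
    case 2
    have "((\<lambda>x. 0) has_real_derivative flat (monom 1 2 * (p - pderiv p)) x) (at x)"
      using 2 by (auto simp: flat_def)
    then show ?thesis
      by (rule has_field_derivative_transform_within_open[where S="{..<0}"])
        (use 2 in \<open>auto simp: flat_def\<close>)
  next
    case 3
    have "((\<lambda>h. flat p h / h) \<longlongrightarrow> 0) (at 0)"
    proof (rule filterlim_split_at)
      have "\<forall>\<^sub>F h in at_left 0. flat p h / h = (0::real)"
        by (auto simp: eventually_at_filter flat_def)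
      then show "((\<lambda>h. flat p h / h) \<longlongrightarrow> 0) (at_left 0)"
        by (rule tendsto_eventually)
      \<comment> \<open>For \<open>h > 0\<close> the difference quotient at 0 is
        \<open>y p(y) exp(-y)\<close> with \<open>y = 1 / h\<close>, so the decay lemma applies with
        exponent 1.\<close>
      have "((\<lambda>h. inverse h ^ 1 * poly p (inverse h) * exp (- inverse h)) \<longlongrightarrow> 0) (at_right (0::real))"
        by (rule filterlim_compose[OF poly_times_exp_neg_tendsto_0 filterlim_inverse_at_top_right])
      then show "((\<lambda>h. flat p h / h) \<longlongrightarrow> 0) (at_right 0)"
        by (rule Lim_transform_eventually)
          (auto simp: eventually_at_filter flat_def field_simps)
    qed
    then show ?thesis
      using 3 by (simp add: has_field_derivative_iff flat_def[of _ 0])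
  qed
qed

lemma flat_1_tendsto_1: "(flat 1 \<longlongrightarrow> 1) at_top"
proof -
  have "((\<lambda>x::real. exp (- inverse x)) \<longlongrightarrow> exp (- 0)) at_top"
    by (intro tendsto_intros tendsto_inverse_0_at_top filterlim_ident)
  then have "((\<lambda>x::real. exp (- inverse x)) \<longlongrightarrow> 1) at_top" by simp
  then show ?thesis
    by (rule Lim_transform_eventually) 
      (use eventually_gt_at_top[of 0] in eventually_elim, simp add: flat_def)
qed

lemma flat_1_bounds: "0 \<le> flat 1 x" "flat 1 x \<le> 1"
  by (auto simp: flat_def)

lemma flat_1_pos: "x > 0 \<Longrightarrow> flat 1 x > 0"
  by (auto simp: flat_def)

text \<open>By the chain and product rules this class of functions is closed under differentiation,
  so all its members are smooth. It is large enough to contain bumps and smooth cutoffs, which are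
  products of two generators.\<close>

inductive flat_alg :: "(real \<Rightarrow> real) \<Rightarrow> bool" where
  base: "flat_alg (\<lambda>t. flat p (m * t + c))"
| add: "flat_alg f \<Longrightarrow> flat_alg g \<Longrightarrow> flat_alg (\<lambda>t. f t + g t)"
| mult: "flat_alg f \<Longrightarrow> flat_alg g \<Longrightarrow> flat_alg (\<lambda>t. f t * g t)"
| scale: "flat_alg f \<Longrightarrow> flat_alg (\<lambda>t. a * f t)"

lemma flat_alg_derivative:
  assumes "flat_alg f"
  shows "\<exists>f'. flat_alg f' \<and> (\<forall>t. (f has_real_derivative f' t) (at t))"
  using assms
proof induction
  case (base p m c)
  let ?q = "monom 1 2 * (p - pderiv p)"
  have "((\<lambda>t. flat p (m * t + c)) has_real_derivative m * flat ?q (m * t + c)) (at t)" for t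
    by (rule DERIV_chain2[where g="\<lambda>t. m * t + c", OF flat_has_derivative, THEN DERIV_cong])
      (auto intro!: derivative_eq_intros)
  then show ?case using flat_alg.scale[OF flat_alg.base] by blast
next
  case (add f g)
  then obtain f' g' where "flat_alg f'" "flat_alg g'"
    "\<forall>t. (f has_real_derivative f' t) (at t)" "\<forall>t. (g has_real_derivative g' t) (at t)" by blast
  then show ?case
    by (intro exI[of _ "\<lambda>t. f' t + g' t"]) (auto intro: flat_alg.intros derivative_intros)
next
  case (mult f g)
  then obtain f' g' where "flat_alg f'" "flat_alg g'"
    "\<forall>t. (f has_real_derivative f' t) (at t)" "\<forall>t. (g has_real_derivative g' t) (at t)" by blast
  then show ?case
    by (intro exI[of _ "\<lambda>t. f' t * g t + g' t * f t"])
      (auto intro!: flat_alg.add flat_alg.mult mult.hyps DERIV_mult)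
next
  case (scale f a)
  then obtain f' where "flat_alg f'" "\<forall>t. (f has_real_derivative f' t) (at t)" by blast
  then show ?case
    by (intro exI[of _ "\<lambda>t. a * f' t"]) (auto intro: flat_alg.intros derivative_intros DERIV_cmult)
qed

lemma flat_alg_deriv: "flat_alg f \<Longrightarrow> flat_alg (deriv f)"
  using flat_alg_derivative[of f] DERIV_imp_deriv[of f] by (metis ext)

lemma flat_alg_smooth: "flat_alg f \<Longrightarrow> ((deriv ^^ n) f) differentiable (at x)"
proof -
  assume "flat_alg f"
  then have "flat_alg ((deriv ^^ n) f)"
    by (induction n) (auto intro: flat_alg_deriv)
  then show ?thesis
    using flat_alg_derivative real_differentiable_def by blast
qed

lemma flat_alg_continuous: "flat_alg f \<Longrightarrow> continuous_on S f"
  using flat_alg_derivative[of f] DERIV_continuous_on[of S f] has_field_derivative_at_within by blast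

text \<open>The primitive from 0 vanishes to the left of \<open>a\<close> because \<open>f\<close>
  does, and to the right of \<open>b\<close> because \<open>f\<close> has mean zero; its support
  therefore stays inside the open unit interval.\<close>

lemma flat_alg_primitive_test01:
  assumes f: "flat_alg f" and ab: "0 < a" "a < b" "b < 1"
    and supp: "\<And>t. t \<notin> {a..b} \<Longrightarrow> f t = 0"
    and I: "(f has_integral 0) {a..b}"
  obtains \<phi> where "test01 \<phi>" "\<And>t. (\<phi> has_real_derivative f t) (at t)"
proof -
  define \<phi> where "\<phi> = (\<lambda>t. integral {0..t} f)"
  have below: "\<phi> t = 0" if "t < a" for t
    unfolding \<phi>_def using that by (intro integral_unique has_integral_is_0) (auto intro: supp)
  have above: "\<phi> t = 0" if "t > b" for t
  proof -
    have "(f has_integral 0) {0..t}"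
      by (rule has_integral_on_superset[OF I]) (use that ab supp in auto)
    then show ?thesis by (simp add: \<phi>_def integral_unique)
  qed
  have D: "(\<phi> has_real_derivative f t) (at t)" for t
  proof (cases "t < a")
    case True
    have "((\<lambda>t. 0) has_real_derivative f t) (at t)"
      using supp[of t] True by auto
    then show ?thesis
      by (rule has_field_derivative_transform_within_open[where S="{..<a}"])
        (use True below in auto)
  next
    case False
    \<comment> \<open>Here \<open>0 < a \<le> t\<close>, so \<open>t\<close> is interior to
      \<open>{0..t + 1}\<close> and the derivative within that interval is the full one.\<close>
    have "(\<phi> has_real_derivative f t) (at t within {0..t + 1})"
      unfolding \<phi>_def
      by (rule integral_has_real_derivative) (use False ab flat_alg_continuous[OF f] in auto)
    then show ?thesis
      using False ab by (simp add: at_within_Icc_at)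
  qed
  have "deriv \<phi> = f"
    using D DERIV_imp_deriv by blast
  then have smooth: "((deriv ^^ n) \<phi>) differentiable (at x)" for n x
  proof (cases n)
    case 0
    then show ?thesis using D real_differentiable_def by auto
  next
    case (Suc m)
    have "(deriv ^^ n) \<phi> = (deriv ^^ m) f"
      unfolding Suc funpow_Suc_right by (simp add: \<open>deriv \<phi> = f\<close>)
    then show ?thesis using flat_alg_smooth[OF f] by simp
  qed
  have "closure {t. \<phi> t \<noteq> 0} \<subseteq> {a..b}"
    by (rule closure_minimal) (use below above in \<open>force simp: not_less[symmetric]\<close>, simp)
  then have "test01 \<phi>"
    unfolding test01_def using smooth ab by force
  then show ?thesis using D that by blast
qed

subsection \<open>Primitives on the unit interval\<close>

lemma finite_measure_I01: "finite_measure I01"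
  by (intro finite_measure_lebesgue_on) simp

lemma pair_sigma_finite_I01: "pair_sigma_finite I01 I01"
  using finite_measure_I01 by (simp add: pair_sigma_finite_def finite_measure_def)

lemma AE_I01_neq: "AE s in I01. s \<noteq> (t::real)"
proof -
  have "AE s in lebesgue. s \<noteq> t"
    by (intro AE_completion AE_lborel_singleton)
  then show ?thesis
    by (auto simp: AE_restrict_space_iff)
qed

lemma measurable_ident_I01 [measurable]: "(\<lambda>x. x) \<in> borel_measurable I01"
  using id_borel_measurable_lebesgue_on[of "{0..1::real}"] by (simp add: id_def)

lemma continuous_on_imp_measurable_I01:
  fixes f :: "real \<Rightarrow> 'a::euclidean_space"
  shows "continuous_on {0..1} f \<Longrightarrow> f \<in> borel_measurable I01"
  by (intro continuous_imp_measurable_on_sets_lebesgue) auto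

lemma continuous_on_imp_integrable_I01:
  fixes f :: "real \<Rightarrow> 'a::euclidean_space"
  shows "continuous_on {0..1} f \<Longrightarrow> integrable I01 f"
  using continuous_imp_integrable[of 0 1 f] by simp

text \<open>For \<open>t\<close> in the unit interval this is the integral of \<open>a\<close> from
  0 to \<open>t\<close>. Keeping the domain fixed and putting \<open>t\<close> into an indicator
  suits dominated convergence and Fubini.\<close>

definition prim :: "(real \<Rightarrow> 'a) \<Rightarrow> real \<Rightarrow> 'a::{banach,second_countable_topology}" where
  "prim a t = integral\<^sup>L I01 (\<lambda>s. indicat_real {..t} s *\<^sub>R a s)"

lemma integrable_indicator_I01:
  fixes a :: "real \<Rightarrow> 'a::{banach,second_countable_topology}"
  assumes "integrable I01 a"
  shows "integrable I01 (\<lambda>s. indicat_real {..t} s *\<^sub>R a s)"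
proof (rule Bochner_Integration.integrable_bound[OF assms])
  have [measurable]: "a \<in> borel_measurable I01" using assms by auto
  show "(\<lambda>s. indicat_real {..t} s *\<^sub>R a s) \<in> borel_measurable I01" by measurable
qed (auto split: split_indicator)

lemma prim_0: "prim a 0 = 0"
  unfolding prim_def
  by (rule integral_eq_zero_AE)
    (use AE_I01_neq[of 0] in \<open>auto simp: AE_restrict_space_iff split: split_indicator elim!: eventually_mono\<close>)

lemma prim_1: "prim a 1 = integral\<^sup>L I01 a"
  unfolding prim_def by (rule Bochner_Integration.integral_cong) auto

text \<open>Dominated convergence: as \<open>X n\<close> tends to \<open>t\<close>, the indicators
  of \<open>{..X n}\<close> converge to that of \<open>{..t}\<close> at every \<open>s\<close> other
  than \<open>t\<close>, and a single point is null.\<close>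

lemma prim_continuous:
  assumes a: "integrable I01 a"
  shows "continuous_on S (prim a)"
proof (rule continuous_on_subset)
  have [measurable]: "a \<in> borel_measurable I01" using a by auto
  show "continuous_on UNIV (prim a)"
    unfolding continuous_on_sequentially comp_def
  proof safe
    fix X :: "nat \<Rightarrow> real" and t assume X: "X \<longlonglongrightarrow> t"
    show "(\<lambda>n. prim a (X n)) \<longlonglongrightarrow> prim a t"
      unfolding prim_def
    proof (rule integral_dominated_convergence[where w="\<lambda>s. norm (a s)"])
      show "AE s in I01. (\<lambda>n. indicat_real {..X n} s *\<^sub>R a s) \<longlonglongrightarrow> indicat_real {..t} s *\<^sub>R a s"
        using AE_I01_neq[of t]
      proof eventually_elim
        case (elim s)
        then consider "s < t" | "t < s" by linarith
        then show ?case
        proof cases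
          case 1
          from X this have "\<forall>\<^sub>F n in sequentially. s < X n" by (rule order_tendstoD)
          then have "\<forall>\<^sub>F n in sequentially. indicat_real {..X n} s *\<^sub>R a s = indicat_real {..t} s *\<^sub>R a s"
            by eventually_elim (use 1 in auto)
          then show ?thesis by (rule tendsto_eventually)
        next
          case 2
          from X this have "\<forall>\<^sub>F n in sequentially. X n < s" by (rule order_tendstoD)
          then have "\<forall>\<^sub>F n in sequentially. indicat_real {..X n} s *\<^sub>R a s = indicat_real {..t} s *\<^sub>R a s"
            by eventually_elim (use 2 in auto)
          then show ?thesis by (rule tendsto_eventually)
        qed
      qed
    qed (use a in \<open>auto split: split_indicator\<close>)
  qed
qed simp

lemma prim_FTC:
  fixes f f' :: "real \<Rightarrow> 'a::euclidean_space"
  assumes D: "\<And>t. (f has_vector_derivative f' t) (at t)" and c: "continuous_on UNIV f'"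
    and t: "t \<in> {0..1}"
  shows "prim f' t = f t - f 0"
proof -
  have c': "continuous_on S f'" for S using c continuous_on_subset by blast
  have "prim f' t = integral\<^sup>L lebesgue (\<lambda>s. indicator {0..1} s *\<^sub>R indicat_real {..t} s *\<^sub>R f' s)"
    unfolding prim_def by (subst integral_restrict_space) auto
  also have "\<dots> = integral\<^sup>L lebesgue (\<lambda>s. indicator {0..t} s *\<^sub>R f' s)"
    by (rule Bochner_Integration.integral_cong) (use t in \<open>auto split: split_indicator\<close>)
  also have "\<dots> = integral\<^sup>L lborel (\<lambda>s. indicator {0..t} s *\<^sub>R f' s)"
    by (rule integral_completion)
      (use borel_integrable_atLeastAtMost'[OF c', of 0 t] in \<open>auto simp: set_integrable_def\<close>)
  also have "\<dots> = f t - f 0"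
    by (rule integral_FTC_atLeastAtMost)
      (use t D c' in \<open>auto intro: has_vector_derivative_at_within\<close>)
  finally show ?thesis .
qed

section \<open>Bilinear pairings and integration by parts for primitives\<close>

lemma bounded_bilinear_measurable:
  fixes h :: "'a::{banach,second_countable_topology} \<Rightarrow> 'b::{banach,second_countable_topology}
    \<Rightarrow> 'c::{banach,second_countable_topology}"
  assumes h: "bounded_bilinear h" and "f \<in> borel_measurable M" "g \<in> borel_measurable M"
  shows "(\<lambda>x. h (f x) (g x)) \<in> borel_measurable M"
proof -
  have "continuous_on UNIV (case_prod h)"
    unfolding case_prod_unfold by (intro bounded_bilinear.continuous_on[OF h] continuous_intros)
  then have "case_prod h \<in> borel_measurable borel"
    by (rule borel_measurable_continuous_onI)
  then show ?thesis
    using measurable_compose[of "\<lambda>t. (f t, g t)" M borel "case_prod h" borel] assms(2,3)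
    by (simp add: borel_prod[symmetric])
qed

lemma bounded_bilinear_integrable_bounded:
  fixes h :: "'a::{banach,second_countable_topology} \<Rightarrow> 'b::{banach,second_countable_topology}
    \<Rightarrow> 'c::{banach,second_countable_topology}"
  assumes h: "bounded_bilinear h"
    and A: "A \<in> borel_measurable M" "\<And>t. t \<in> space M \<Longrightarrow> norm (A t) \<le> C" and b: "integrable M b"
  shows "integrable M (\<lambda>t. h (A t) (b t))"
proof -
  interpret bounded_bilinear h by fact
  obtain K where K: "K > 0" "\<And>x y. norm (h x y) \<le> norm x * norm y * K"
    using pos_bounded by blast
  have [measurable]: "A \<in> borel_measurable M" "b \<in> borel_measurable M" using A b by auto
  have [measurable]: "(\<lambda>t. h (A t) (b t)) \<in> borel_measurable M"
    by (rule bounded_bilinear_measurable[OF h]) measurable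
  show ?thesis
  proof (rule Bochner_Integration.integrable_bound[of _ "\<lambda>t. C * K * norm (b t)"])
    show "AE t in M. norm (h (A t) (b t)) \<le> norm (C * K * norm (b t))"
    proof (rule AE_I2)
      fix t assume "t \<in> space M"
      then have "norm (A t) * norm (b t) * K \<le> C * norm (b t) * K"
        using A(2) K(1) by (intro mult_right_mono) auto
      then show "norm (h (A t) (b t)) \<le> norm (C * K * norm (b t))"
        using K(2)[of "A t" "b t"] by (simp add: mult_ac)
    qed
  qed (use b in auto)
qed

lemma bounded_bilinear_integrable_continuous:
  fixes h :: "'a::euclidean_space \<Rightarrow> 'b::{banach,second_countable_topology}
    \<Rightarrow> 'c::{banach,second_countable_topology}"
  assumes h: "bounded_bilinear h" and A: "continuous_on {0..1} A" and b: "integrable I01 b"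
  shows "integrable I01 (\<lambda>t. h (A t) (b t))"
proof -
  have "bounded (A ` {0..1})"
    using A compact_Icc compact_continuous_image compact_imp_bounded by blast
  then have "\<exists>C. \<forall>t\<in>{0..1}. norm (A t) \<le> C"
    by (auto simp: bounded_iff)
  then obtain C where "\<And>t. t \<in> {0..1} \<Longrightarrow> norm (A t) \<le> C" by blast
  then show ?thesis
    by (intro bounded_bilinear_integrable_bounded[OF h _ _ b, of A C] continuous_on_imp_measurable_I01 A) auto
qed

text \<open>Fubini: both sides are integrals of \<open>h (a s) (b t)\<close> over the two triangles
  \<open>s \<le> t\<close> and \<open>t \<le> s\<close> of the unit square.\<close>
lemma prim_integration_by_parts:
  fixes h :: "'a::euclidean_space \<Rightarrow> 'b::euclidean_space \<Rightarrow> 'c::euclidean_space"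
  assumes h: "bounded_bilinear h" and a: "integrable I01 a" and b: "integrable I01 b"
  shows "integral\<^sup>L I01 (\<lambda>t. h (prim a t) (b t)) + integral\<^sup>L I01 (\<lambda>t. h (a t) (prim b t))
    = h (integral\<^sup>L I01 a) (integral\<^sup>L I01 b)"
proof -
  interpret bounded_bilinear h by fact
  interpret P: pair_sigma_finite I01 I01 by (rule pair_sigma_finite_I01)
  obtain K where K: "K > 0" "\<And>x y. norm (h x y) \<le> norm x * norm y * K"
    using pos_bounded by blast
  have [measurable]: "a \<in> borel_measurable I01" "b \<in> borel_measurable I01" using a b by auto
  note hm = bounded_bilinear_measurable[OF h]
  let ?F = "\<lambda>(s, t). indicat_real {..t} s *\<^sub>R h (a s) (b t)"
  have Fm [measurable]: "?F \<in> borel_measurable (I01 \<Otimes>\<^sub>M I01)"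
    unfolding indicator_def atMost_iff case_prod_unfold by (measurable; rule hm; measurable)
  have hb: "integrable I01 (\<lambda>t. h x (b t))" for x
    by (rule integrable_bounded_linear[OF bounded_linear_right b])
  have ha: "integrable I01 (\<lambda>t. h (a t) x)" for x
    by (rule integrable_bounded_linear[OF bounded_linear_left a])
  have Fs: "integrable I01 (\<lambda>t. ?F (s, t))" if "s \<in> {0..1}" for s
  proof (rule Bochner_Integration.integrable_bound[OF hb[of "a s"]])
    show "(\<lambda>t. ?F (s, t)) \<in> borel_measurable I01"
      unfolding indicator_def atMost_iff prod.case by (measurable; rule hm; measurable)
  qed (auto split: split_indicator)
  have "integrable (I01 \<Otimes>\<^sub>M I01) ?F"
  proof (rule P.Fubini_integrable)
    show "AE s in I01. integrable I01 (\<lambda>t. ?F (s, t))"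
      by (rule AE_I2) (simp only: space_lebesgue_on Fs)
    show "integrable I01 (\<lambda>s. \<integral> t. norm (?F (s, t)) \<partial>I01)"
    proof (rule Bochner_Integration.integrable_bound)
      show "integrable I01 (\<lambda>s. norm (a s) * (K * (\<integral>t. norm (b t) \<partial>I01)))"
        using a by auto
      show "(\<lambda>s. \<integral> t. norm (?F (s, t)) \<partial>I01) \<in> borel_measurable I01"
        by measurable
      show "AE s in I01. norm (\<integral> t. norm (?F (s, t)) \<partial>I01)
          \<le> norm (norm (a s) * (K * (\<integral>t. norm (b t) \<partial>I01)))"
      proof (rule AE_I2)
        fix s :: real assume "s \<in> space I01"
        then have s: "s \<in> {0..1}" by simp
        have "(\<integral> t. norm (?F (s, t)) \<partial>I01) \<le> (\<integral> t. norm (a s) * K * norm (b t) \<partial>I01)"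
        proof (rule integral_mono)
          show "norm (?F (s, t)) \<le> norm (a s) * K * norm (b t)" for t
            using K(2)[of "a s" "b t"] K(1) by (auto simp: mult_ac split: split_indicator)
        qed (use integrable_norm[OF Fs[OF s]] b in auto)
        then show "norm (\<integral> t. norm (?F (s, t)) \<partial>I01)
            \<le> norm (norm (a s) * (K * (\<integral>t. norm (b t) \<partial>I01)))"
          using K(1) by (simp add: mult_ac)
      qed
    qed
  qed measurable
  then have "(\<integral>t. \<integral>s. indicat_real {..t} s *\<^sub>R h (a s) (b t) \<partial>I01 \<partial>I01)
     = (\<integral>s. \<integral>t. indicat_real {..t} s *\<^sub>R h (a s) (b t) \<partial>I01 \<partial>I01)"
    by (rule P.Fubini_integral)
  moreover have "(\<integral>s. indicat_real {..t} s *\<^sub>R h (a s) (b t) \<partial>I01) = h (prim a t) (b t)" for t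
    using integral_bounded_linear[OF bounded_linear_left[of "b t"] integrable_indicator_I01[OF a, of t]]
    by (simp add: prim_def scaleR_left)
  \<comment> \<open>Integrating over \<open>t \<ge> s\<close> means subtracting the part
    \<open>t \<le> s\<close> from the whole integral; the point \<open>t = s\<close>, which lies in
    both ranges, is null.\<close>
  moreover have "(\<integral>t. indicat_real {..t} s *\<^sub>R h (a s) (b t) \<partial>I01)
    = h (a s) (integral\<^sup>L I01 b) - h (a s) (prim b s)" for s
  proof -
    have "(\<integral>t. indicat_real {..t} s *\<^sub>R h (a s) (b t) \<partial>I01)
      = (\<integral>t. h (a s) (b t) - h (a s) (indicat_real {..s} t *\<^sub>R b t) \<partial>I01)"
    proof (rule integral_cong_AE)
      show "AE t in I01. indicat_real {..t} s *\<^sub>R h (a s) (b t)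
          = h (a s) (b t) - h (a s) (indicat_real {..s} t *\<^sub>R b t)"
        using AE_I01_neq[of s] by eventually_elim (auto simp: zero_right split: split_indicator)
      show "(\<lambda>t. indicat_real {..t} s *\<^sub>R h (a s) (b t)) \<in> borel_measurable I01"
        unfolding indicator_def atMost_iff by (measurable; rule hm; measurable)
      show "(\<lambda>t. h (a s) (b t) - h (a s) (indicat_real {..s} t *\<^sub>R b t)) \<in> borel_measurable I01"
        using hb integrable_bounded_linear[OF bounded_linear_right integrable_indicator_I01[OF b, of s]]
        by (intro borel_measurable_diff) auto
    qed
    also have "\<dots> = h (a s) (integral\<^sup>L I01 b) - h (a s) (prim b s)"
      using hb integrable_bounded_linear[OF bounded_linear_right integrable_indicator_I01[OF b, of s]]
        integral_bounded_linear[OF bounded_linear_right b]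
        integral_bounded_linear[OF bounded_linear_right integrable_indicator_I01[OF b, of s]]
      by (simp add: prim_def)
    finally show ?thesis .
  qed
  moreover have "(\<integral>s. h (a s) (integral\<^sup>L I01 b) - h (a s) (prim b s) \<partial>I01)
    = h (integral\<^sup>L I01 a) (integral\<^sup>L I01 b) - (\<integral>s. h (a s) (prim b s) \<partial>I01)"
    using ha integral_bounded_linear[OF bounded_linear_left a]
      bounded_bilinear_integrable_continuous[OF bounded_bilinear.flip[OF h] prim_continuous[OF b] a]
    by simp
  ultimately show ?thesis by simp
qed

subsection \<open>The du Bois-Reymond lemma\<close>

text \<open>The positive and negative parts of \<open>h\<close> are densities of two finite
  measures. They agree on all rays \<open>{a<..}\<close>, hence on all Borel sets, so the densities
  agree almost everywhere.\<close>

lemma AE_zero_if_ray_integrals_zero_real: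
  fixes h :: "real \<Rightarrow> real"
  assumes h: "integrable I01 h" and z: "\<And>a. integral\<^sup>L I01 (\<lambda>t. indicator {a<..} t *\<^sub>R h t) = 0"
  shows "AE t in I01. h t = 0"
proof -
  let ?k = "\<lambda>t. indicat_real {0..1} t *\<^sub>R h t"
  have k: "integrable lebesgue ?k"
    using h by (subst (asm) integrable_restrict_space) auto
  \<comment> \<open>A Borel version of \<open>h\<close> extended by zero: the uniqueness argument
    for measures takes place on \<open>lborel\<close>, while \<open>h\<close> is only Lebesgue
    measurable.\<close>
  then obtain g where g [measurable]: "g \<in> borel_measurable lborel" and eq: "AE t in lborel. ?k t = g t"
    using completion_ex_borel_measurable_real by blast
  have eq': "AE t in lebesgue. ?k t = g t"
    using eq by (rule AE_completion)
  have "integrable lebesgue g"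
    by (rule integrable_cong_AE_imp[OF k]) (use eq' in \<open>auto simp: measurable_completion\<close>)
  then have gi [simp]: "integrable lborel g"
    by (simp add: integrable_completion)
  have zg: "integral\<^sup>L lborel (\<lambda>t. indicator {a<..} t * g t) = 0" for a :: real
  proof -
    have "integral\<^sup>L lborel (\<lambda>t. indicator {a<..} t * g t)
        = integral\<^sup>L lebesgue (\<lambda>t. indicator {a<..} t * g t)"
      by (rule integral_completion[symmetric]) measurable
    also have "\<dots> = integral\<^sup>L lebesgue (\<lambda>t. indicator {0..1} t *\<^sub>R indicat_real {a<..} t *\<^sub>R h t)"
    proof (rule integral_cong_AE)
      show "(\<lambda>t. indicator {a<..} t * g t) \<in> borel_measurable lebesgue"
        by (rule measurable_completion) measurable
      have "integrable lebesgue (\<lambda>t. indicat_real {a<..} t *\<^sub>R ?k t)"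
        by (rule integrable_mult_indicator[OF _ k]) auto
      then show "(\<lambda>t. indicat_real {0..1} t *\<^sub>R indicat_real {a<..} t *\<^sub>R h t) \<in> borel_measurable lebesgue"
        using borel_measurable_integrable by (simp add: mult_ac)
      show "AE t in lebesgue. indicator {a<..} t * g t
          = indicator {0..1} t *\<^sub>R indicat_real {a<..} t *\<^sub>R h t"
        using eq' by eventually_elim (auto simp: mult_ac)
    qed
    also have "\<dots> = 0"
      using z[of a] by (subst (asm) integral_restrict_space) auto
    finally show ?thesis .
  qed
  define p where "p = (\<lambda>t. max 0 (g t))"
  define n where "n = (\<lambda>t. max 0 (- g t))"
  have [measurable]: "p \<in> borel_measurable lborel" "n \<in> borel_measurable lborel"
    unfolding p_def n_def by measurable
  have pi: "integrable lborel p"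
    by (rule Bochner_Integration.integrable_bound[OF gi]) (auto simp: p_def)
  have ni: "integrable lborel n"
    by (rule Bochner_Integration.integrable_bound[OF gi]) (auto simp: n_def)
  have em: "emeasure (density lborel (\<lambda>t. ennreal (q t))) A = ennreal (integral\<^sup>L lborel (\<lambda>t. indicator A t * q t))"
    if q: "integrable lborel q" "\<And>t. 0 \<le> q t" and A [measurable]: "A \<in> sets lborel" for q A
  proof -
    have [measurable]: "q \<in> borel_measurable lborel" using q by auto
    have "emeasure (density lborel (\<lambda>t. ennreal (q t))) A = (\<integral>\<^sup>+ t. ennreal (indicator A t * q t) \<partial>lborel)"
      using A by (subst emeasure_density) (auto intro!: nn_integral_cong split: split_indicator)
    also have "\<dots> = ennreal (integral\<^sup>L lborel (\<lambda>t. indicator A t * q t))"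
      by (rule nn_integral_eq_integral)
        (use q A integrable_mult_indicator[OF A q(1)] in auto)
    finally show ?thesis .
  qed
  have "density lborel (\<lambda>t. ennreal (p t)) = density lborel (\<lambda>t. ennreal (n t))"
  proof (rule measure_eqI_lessThan)
    fix a :: real
    have "integral\<^sup>L lborel (\<lambda>t. indicator {a<..} t * g t)
      = integral\<^sup>L lborel (\<lambda>t. indicator {a<..} t * p t - indicator {a<..} t * n t)"
      by (rule Bochner_Integration.integral_cong) (auto simp: p_def n_def split: split_indicator)
    also have "\<dots> = integral\<^sup>L lborel (\<lambda>t. indicator {a<..} t * p t) - integral\<^sup>L lborel (\<lambda>t. indicator {a<..} t * n t)"
      using integrable_mult_indicator[of "{a<..}" lborel p] integrable_mult_indicator[of "{a<..}" lborel n] pi ni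
      by (intro Bochner_Integration.integral_diff) auto
    finally have "integral\<^sup>L lborel (\<lambda>t. indicator {a<..} t * p t) = integral\<^sup>L lborel (\<lambda>t. indicator {a<..} t * n t)"
      using zg[of a] by simp
    then show "emeasure (density lborel (\<lambda>t. ennreal (p t))) {a<..} = emeasure (density lborel (\<lambda>t. ennreal (n t))) {a<..}"
      by (subst (1 2) em) (use pi ni in \<open>auto simp: p_def n_def\<close>)
    show "emeasure (density lborel (\<lambda>t. ennreal (p t))) {a<..} < \<infinity>"
      by (subst em) (use pi in \<open>auto simp: p_def\<close>)
  qed auto
  then have "integral\<^sup>L lborel (\<lambda>t. indicator A t * p t) = integral\<^sup>L lborel (\<lambda>t. indicator A t * n t)"
    if "A \<in> sets lborel" for A
    using em[OF pi _ that] em[OF ni _ that]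
    by (simp add: p_def n_def integral_nonneg_AE)
  then have "AE t in lborel. p t = n t"
    by (intro density_unique_real pi ni) (simp add: set_lebesgue_integral_def)
  then have "AE t in lborel. ?k t = 0"
    using eq by eventually_elim (auto simp: p_def n_def max_def split: if_splits)
  then have "AE t in lebesgue. ?k t = 0"
    by (rule AE_completion)
  then show ?thesis
    by (subst AE_restrict_space_iff) (auto split: split_indicator elim!: eventually_mono)
qed

text \<open>Each coordinate falls under the real case, and finitely many exceptional null sets are
  united.\<close>

lemma AE_zero_if_ray_integrals_zero:
  fixes h :: "real \<Rightarrow> 'a::euclidean_space"
  assumes h: "integrable I01 h" and z: "\<And>a. integral\<^sup>L I01 (\<lambda>t. indicator {a<..} t *\<^sub>R h t) = 0"
  shows "AE t in I01. h t = 0"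
proof -
  have [measurable]: "h \<in> borel_measurable I01" using h by auto
  have "AE t in I01. h t \<bullet> b = 0" for b
  proof (rule AE_zero_if_ray_integrals_zero_real)
    show "integrable I01 (\<lambda>t. h t \<bullet> b)"
      using h by auto
    show "integral\<^sup>L I01 (\<lambda>t. indicat_real {a<..} t *\<^sub>R (h t \<bullet> b)) = 0" for a
    proof -
      have "integrable I01 (\<lambda>t. indicat_real {a<..} t *\<^sub>R h t)"
        by (rule Bochner_Integration.integrable_bound[OF h])
          (auto simp: indicator_def intro!: borel_measurable_scaleR split: split_indicator)
      then show ?thesis
        using integral_inner_left[of b I01 "\<lambda>t. indicat_real {a<..} t *\<^sub>R h t"] z[of a] by simp
    qed
  qed
  then have "AE t in I01. \<forall>b\<in>Basis. h t \<bullet> b = 0"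
    by (simp add: AE_ball_countable countable_finite)
  then show ?thesis
    by eventually_elim (auto intro: euclidean_eqI)
qed

text \<open>A function \<open>f\<close> of \<open>flat_alg\<close> supported inside the interval
  becomes the derivative of a test function once the multiple of a fixed bump \<psi> with the same
  integral is subtracted. Hence \<open>g - c\<close> is orthogonal to every such \<open>f\<close>,
  where \<open>c\<close> is the \<psi>-weighted mean of \<open>g\<close>. Letting \<open>f\<close>
  approach indicators of rays shows that \<open>g - c\<close> vanishes almost everywhere.\<close>

lemma du_Bois_Reymond:
  fixes g :: "real \<Rightarrow> 'a::euclidean_space"
  assumes g: "integrable I01 g"
    and z: "\<And>\<phi>. test01 \<phi> \<Longrightarrow> integral\<^sup>L I01 (\<lambda>t. deriv \<phi> t *\<^sub>R g t) = 0"
  shows "\<exists>c. AE t in I01. g t = c"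
proof -
  \<comment> \<open>A bump that is positive exactly on the interval from 1/4 to 3/4.\<close>
  define \<psi> where "\<psi> = (\<lambda>t. flat 1 (4 * t + (-1)) * flat 1 ((-4) * t + 3))"
  have \<psi>: "flat_alg \<psi>"
    unfolding \<psi>_def by (intro flat_alg.intros)
  have prodi: "integrable I01 (\<lambda>t. f t *\<^sub>R k t)" if "flat_alg f" "integrable I01 k" for f and k :: "real \<Rightarrow> 'a"
    by (rule bounded_bilinear_integrable_continuous[OF bounded_bilinear_scaleR flat_alg_continuous[OF that(1)] that(2)])
  have fi: "integrable I01 f" if "flat_alg f" for f
    by (intro continuous_on_imp_integrable_I01 flat_alg_continuous that)
  define K where "K = integral\<^sup>L I01 \<psi>"
  have "K > 0"
  proof -
    have "0 \<le> K" unfolding K_def \<psi>_def by (intro integral_nonneg_AE AE_I2 mult_nonneg_nonneg flat_1_bounds)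
    moreover have "K \<noteq> 0"
    proof
      assume "K = 0"
      have "(\<psi> has_integral 0) (cbox 0 1)"
        using has_integral_integral_lebesgue_on[OF fi[OF \<psi>]] \<open>K = 0\<close> by (simp add: K_def)
      then have "\<psi> (1/2) = 0"
        using flat_alg_continuous[OF \<psi>]
        by (intro has_integral_0_cbox_imp_0[of 0 1 \<psi> "1/2"])
          (auto simp: \<psi>_def intro!: mult_nonneg_nonneg flat_1_bounds)
      then show False
        using flat_1_pos[of 1] by (simp add: \<psi>_def)
    qed
    ultimately show ?thesis by simp
  qed
  \<comment> \<open>The only constant for which \<psi> is orthogonal to
    \<open>g - c\<close>.\<close>
  define c where "c = inverse K *\<^sub>R integral\<^sup>L I01 (\<lambda>t. \<psi> t *\<^sub>R g t)"
  have orth: "integral\<^sup>L I01 (\<lambda>t. f t *\<^sub>R (g t - c)) = 0"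
    if f: "flat_alg f" and supp: "0 < a" "b < 1" "\<And>t. t \<notin> {a..b} \<Longrightarrow> f t = 0" for f a b
  proof -
    let ?m = "integral\<^sup>L I01 f * inverse K"
    let ?f = "\<lambda>t. f t + (- ?m) * \<psi> t"
    have fa: "flat_alg ?f"
      by (intro flat_alg.intros f \<psi>)
    \<comment> \<open>One interval containing the supports of both \<open>f\<close> and \<psi>,
      still strictly inside the unit interval.\<close>
    define a' b' where "a' = min a (1/4)" and "b' = max b (3/4)"
    have supp': "?f t = 0" if "t \<notin> {a'..b'}" for t
    proof -
      have "f t = 0"
        by (rule supp(3)) (use that in \<open>auto simp: a'_def b'_def\<close>)
      moreover have "\<psi> t = 0"
        using that by (auto simp: a'_def b'_def \<psi>_def flat_def)
      ultimately show ?thesis by simp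
    qed
    have "integral\<^sup>L I01 ?f = 0"
      using fi[OF f] fi[OF \<psi>] \<open>K > 0\<close> by (simp add: K_def[symmetric])
    then have "(?f has_integral 0) {0..1}"
      using has_integral_integral_lebesgue_on[OF fi[OF fa]] by simp
    then have "((\<lambda>t. if t \<in> {a'..b'} then ?f t else 0) has_integral 0) {0..1}"
      by (rule has_integral_eq[rotated]) (use supp' in auto)
    then have "(?f has_integral 0) {a'..b'}"
      using supp by (subst (asm) has_integral_restrict) (auto simp: a'_def b'_def)
    moreover have "0 < a'" "a' < b'" "b' < 1"
      using supp(1,2) by (auto simp: a'_def b'_def)
    ultimately obtain \<phi> where \<phi>: "test01 \<phi>" "\<And>t. (\<phi> has_real_derivative ?f t) (at t)"
      using flat_alg_primitive_test01[OF fa _ _ _ supp'] by blast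
    have "deriv \<phi> = ?f" using \<phi>(2) DERIV_imp_deriv by blast
    then have "0 = integral\<^sup>L I01 (\<lambda>t. f t *\<^sub>R g t - ?m *\<^sub>R (\<psi> t *\<^sub>R g t))"
      using z[OF \<phi>(1)] by (simp add: algebra_simps)
    also have "\<dots> = integral\<^sup>L I01 (\<lambda>t. f t *\<^sub>R g t) - ?m *\<^sub>R integral\<^sup>L I01 (\<lambda>t. \<psi> t *\<^sub>R g t)"
      using prodi[OF f g] prodi[OF \<psi> g] by (simp del: scaleR_scaleR)
    also have "\<dots> = integral\<^sup>L I01 (\<lambda>t. f t *\<^sub>R g t) - integral\<^sup>L I01 f *\<^sub>R c"
      by (simp add: c_def)
    also have "\<dots> = integral\<^sup>L I01 (\<lambda>t. f t *\<^sub>R (g t - c))"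
      using prodi[OF f g] fi[OF f] by (simp add: scaleR_diff_right)
    finally show ?thesis by simp
  qed
  have gc: "integrable I01 (\<lambda>t. g t - c)" using g by simp
  have "AE t in I01. g t - c = 0"
  proof (rule AE_zero_if_ray_integrals_zero[OF gc])
    fix a :: real
    \<comment> \<open>Clipping at 0 leaves the trace of the ray on the positive half-line unchanged
      and keeps the supports below away from 0.\<close>
    define a0 where "a0 = max a 0"
    \<comment> \<open>With \<open>N = Suc n\<close>, this cutoff is positive exactly between
      \<open>a0 + 1/N\<close> and \<open>1 - 1/N\<close>.\<close>
    define f where "f = (\<lambda>n t. flat 1 (real (Suc n) * t + (- real (Suc n) * a0 - 1))
       * flat 1 ((- real (Suc n)) * t + (real (Suc n) - 1)))"
    have f: "flat_alg (f n)" for n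
      unfolding f_def by (intro flat_alg.intros)
    have zn: "integral\<^sup>L I01 (\<lambda>t. f n t *\<^sub>R (g t - c)) = 0" for n
    \<comment> \<open>For \<open>n = 0\<close> the interval passed to \<open>orth\<close> is empty
      and \<open>f 0\<close> vanishes identically, which \<open>orth\<close> permits.\<close>
    proof (rule orth[OF f])
      show "0 < inverse (real (Suc n))" "1 - inverse (real (Suc n)) < 1" by auto
      fix t assume "t \<notin> {inverse (real (Suc n))..1 - inverse (real (Suc n))}"
      then consider "t < inverse (real (Suc n))" | "t > 1 - inverse (real (Suc n))" by force
      then show "f n t = 0"
      proof cases
        case 1
        then have "real (Suc n) * t < 1" by (simp add: field_simps)
        moreover have "real (Suc n) * a0 \<ge> 0" by (simp add: a0_def)
        ultimately have "\<not> 0 < real (Suc n) * t + (- real (Suc n) * a0 - 1)"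
          unfolding mult_minus_left by linarith
        then show ?thesis unfolding f_def flat_def by simp
      next
        case 2
        then have "real (Suc n) * t > real (Suc n) - 1" by (simp add: field_simps)
        then have "\<not> 0 < (- real (Suc n)) * t + (real (Suc n) - 1)"
          unfolding mult_minus_left by linarith
        then show ?thesis unfolding f_def flat_def by simp
      qed
    qed
    have "(\<lambda>n. integral\<^sup>L I01 (\<lambda>t. f n t *\<^sub>R (g t - c)))
        \<longlonglongrightarrow> integral\<^sup>L I01 (\<lambda>t. indicat_real {a<..} t *\<^sub>R (g t - c))"
    proof (rule integral_dominated_convergence[where w="\<lambda>t. norm (g t - c)"])
      \<comment> \<open>Both factors of \<open>f n t\<close> have this form, with
        \<open>d = t - a0\<close> and \<open>d = 1 - t\<close>.\<close>
      have lin: "(\<lambda>n. flat 1 (real (Suc n) * d - 1)) \<longlonglongrightarrow> 1" if "d > 0" for d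
      proof (rule filterlim_compose[OF flat_1_tendsto_1])
        have "filterlim (\<lambda>n. d * real (Suc n)) at_top sequentially"
          by (intro filterlim_tendsto_pos_mult_at_top[OF tendsto_const that]
             filterlim_compose[OF filterlim_real_sequentially filterlim_Suc])
        then have "filterlim (\<lambda>n. - 1 + d * real (Suc n)) at_top sequentially"
          by (rule filterlim_tendsto_add_at_top[OF tendsto_const])
        then show "filterlim (\<lambda>n. real (Suc n) * d - 1) at_top sequentially"
          by (simp add: mult_ac)
      qed
      show "AE t in I01. (\<lambda>n. f n t *\<^sub>R (g t - c)) \<longlonglongrightarrow> indicat_real {a<..} t *\<^sub>R (g t - c)"
        using AE_I01_neq[of 0] AE_I01_neq[of 1] AE_space
      proof eventually_elim
        case (elim t)
        then have t: "0 < t" "t < 1" by auto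
        have "(\<lambda>n. f n t) \<longlonglongrightarrow> indicat_real {a<..} t"
        proof (cases "a < t")
          case True
          then have "t - a0 > 0" using t by (auto simp: a0_def)
          then have "(\<lambda>n. flat 1 (real (Suc n) * (t - a0) - 1) * flat 1 (real (Suc n) * (1 - t) - 1)) \<longlonglongrightarrow> 1 * 1"
            using t by (intro tendsto_mult lin) auto
          moreover have "(\<lambda>n. flat 1 (real (Suc n) * (t - a0) - 1) * flat 1 (real (Suc n) * (1 - t) - 1)) = (\<lambda>n. f n t)"
            by (simp add: f_def algebra_simps)
          ultimately show ?thesis using True by simp
        next
          case False
          then have "t - a0 \<le> 0" by (auto simp: a0_def)
          then have "real (Suc n) * (t - a0) \<le> 0" for n
            by (intro mult_nonneg_nonpos) auto
          then have "real (Suc n) * t \<le> real (Suc n) * a0" for n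
            by (simp add: right_diff_distrib)
          then have "f n t = 0" for n
            unfolding f_def by (smt (verit) flat_def mult_eq_0_iff mult_minus_left)
          then show ?thesis using False by simp
        qed
        then show ?case by (intro tendsto_intros)
      qed
      show "AE t in I01. norm (f n t *\<^sub>R (g t - c)) \<le> norm (g t - c)" for n
      proof (rule AE_I2)
        fix t
        have "\<bar>f n t\<bar> \<le> 1"
          unfolding f_def abs_mult by (intro mult_le_one) (use flat_1_bounds in auto)
        then show "norm (f n t *\<^sub>R (g t - c)) \<le> norm (g t - c)"
          by (simp add: mult_left_le_one_le)
      qed
      show "(\<lambda>t. f n t *\<^sub>R (g t - c)) \<in> borel_measurable I01" for n
        using prodi[OF f gc] by auto
      show "(\<lambda>t. indicat_real {a<..} t *\<^sub>R (g t - c)) \<in> borel_measurable I01"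
        using g unfolding indicator_def greaterThan_iff by measurable
    qed (use gc in auto)
    then show "integral\<^sup>L I01 (\<lambda>t. indicat_real {a<..} t *\<^sub>R (g t - c)) = 0"
      by (simp add: zn LIMSEQ_const_iff)
  qed
  then show ?thesis by (auto intro!: exI[of _ c])
qed

subsection \<open>Weak derivatives and the \<open>L\<^sup>2\<close> inner product\<close>

text \<open>The difference \<open>u - prim w\<close> has weak derivative zero: a test function
  \<phi> is the primitive of its own derivative, and integrating by parts against
  \<open>prim w\<close> leaves no boundary term since \<phi> vanishes at 1. The du Bois-Reymond
  lemma then supplies the constant, and with it a continuous representative of
  \<open>u\<close>.\<close>

lemma wder_representation:
  fixes u w :: "real \<Rightarrow> complex^'n"
  assumes u: "integrable I01 u" and w: "integrable I01 w" and uw: "wder u w"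
  obtains c where "AE t in I01. u t = c + prim w t"
proof -
  have wp: "integrable I01 (prim w)"
    by (intro continuous_on_imp_integrable_I01 prim_continuous w)
  have "\<exists>c. AE t in I01. u t - prim w t = c"
  proof (rule du_Bois_Reymond)
    show "integrable I01 (\<lambda>t. u t - prim w t)"
      using u wp by simp
    fix \<phi> assume \<phi>: "test01 \<phi>"
    have "\<phi> differentiable (at x)" "deriv \<phi> differentiable (at x)" for x
      using \<phi>[unfolded test01_def, THEN conjunct1, rule_format, of 0 x]
        \<phi>[unfolded test01_def, THEN conjunct1, rule_format, of 1 x] by simp_all
    then have D: "(\<phi> has_vector_derivative deriv \<phi> x) (at x)"
      and c: "continuous_on S (deriv \<phi>)" "continuous_on S \<phi>" for x S
      by (auto simp: DERIV_deriv_iff_real_differentiable has_real_derivative_iff_has_vector_derivative[symmetric]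
         intro!: continuous_at_imp_continuous_on differentiable_imp_continuous_within)
    have 0: "\<phi> 0 = 0" "\<phi> 1 = 0"
      using \<phi> closure_subset[of "{t. \<phi> t \<noteq> 0}"] by (auto simp: test01_def)
    have p: "prim (deriv \<phi>) t = \<phi> t" if "t \<in> {0..1}" for t
      using prim_FTC[OF D c(1) that] 0 by simp
    have "integral\<^sup>L I01 (\<lambda>t. \<phi> t *\<^sub>R w t) + integral\<^sup>L I01 (\<lambda>t. deriv \<phi> t *\<^sub>R prim w t)
        = integral\<^sup>L I01 (\<lambda>t. prim (deriv \<phi>) t *\<^sub>R w t) + integral\<^sup>L I01 (\<lambda>t. deriv \<phi> t *\<^sub>R prim w t)"
      by (intro arg_cong2[where f="(+)"] Bochner_Integration.integral_cong) (auto simp: p)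
    also have "\<dots> = integral\<^sup>L I01 (deriv \<phi>) *\<^sub>R integral\<^sup>L I01 w"
      by (rule prim_integration_by_parts[OF bounded_bilinear_scaleR continuous_on_imp_integrable_I01[OF c(1)] w])
    also have "\<dots> = 0"
      using p[of 1] 0 by (simp add: prim_1)
    finally show "integral\<^sup>L I01 (\<lambda>t. deriv \<phi> t *\<^sub>R (u t - prim w t)) = 0"
      using uw \<phi> bounded_bilinear_integrable_continuous[OF bounded_bilinear_scaleR c(1) u]
        bounded_bilinear_integrable_continuous[OF bounded_bilinear_scaleR c(1) wp]
      by (simp add: wder_def scaleR_diff_right add_eq_0_iff)
  qed
  then obtain c where "AE t in I01. u t - prim w t = c" by blast
  then have "AE t in I01. u t = c + prim w t"
    by eventually_elim (simp add: algebra_simps)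
  then show thesis by (rule that)
qed

text \<open>The continuous nonnegative function \<open>norm (v t - w t)\<close> has integral zero,
  so it vanishes at every point, endpoints included. This is what makes \<open>ev\<close> well
  defined.\<close>

lemma continuous_AE_eq_I01:
  fixes v w :: "real \<Rightarrow> 'a::euclidean_space"
  assumes c: "continuous_on {0..1} v" "continuous_on {0..1} w"
    and eq: "AE t in I01. v t = w t" and t: "t \<in> {0..1}"
  shows "v t = w t"
proof -
  have d: "continuous_on {0..1} (\<lambda>t. norm (v t - w t))"
    by (intro continuous_intros c)
  have "integral\<^sup>L I01 (\<lambda>t. norm (v t - w t)) = 0"
    by (rule integral_eq_zero_AE) (use eq in eventually_elim, simp)
  then have "((\<lambda>t. norm (v t - w t)) has_integral 0) (cbox 0 1)"
    using has_integral_integral_lebesgue_on[OF continuous_on_imp_integrable_I01[OF d]] by simp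
  then have "norm (v t - w t) = 0"
    by (intro has_integral_0_cbox_imp_0[of 0 1 "\<lambda>t. norm (v t - w t)"]) (use d t in auto)
  then show ?thesis by simp
qed

lemma ev_eq:
  assumes "continuous_on {0..1} v" "AE s in I01. u s = v s" "t \<in> {0..1}"
  shows "ev u t = v t"
  unfolding ev_def
proof (rule the_equality)
  show "\<exists>v'. continuous_on {0..1} v' \<and> (AE s in I01. u s = v' s) \<and> v' t = v t"
    using assms by blast
  fix c assume "\<exists>v'. continuous_on {0..1} v' \<and> (AE s in I01. u s = v' s) \<and> v' t = c"
  then obtain v' where v': "continuous_on {0..1} v'" "AE s in I01. u s = v' s" "v' t = c" by blast
  have "AE s in I01. v s = v' s"
    using assms(2) v'(2) by eventually_elim simp
  then show "c = v t"
    using continuous_AE_eq_I01[OF assms(1) v'(1) _ assms(3)] v'(3) by simp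
qed

section \<open>The Hermitian product, its \<open>L\<^sup>2\<close> pairing and integration by
  parts\<close>

lemma bounded_bilinear_cdot: "bounded_bilinear cdot"
  unfolding bilinear_conv_bounded_bilinear[symmetric] bilinear_def
  by (auto intro!: linearI simp: cdot_def algebra_simps sum.distrib scaleR_sum_right)

lemma cnj_cdot: "cnj (cdot u v) = cdot v u"
  by (simp add: cdot_def mult.commute)

lemma cnj_ipL2: "cnj (ipL2 M f g) = ipL2 M g f"
  by (simp add: ipL2_def Bochner_Integration.integral_cnj[symmetric] cnj_cdot)

text \<open>The pointwise bound of \<open>norm y\<close> by \<open>1 + (norm y)^2\<close> suffices
  because the unit interval has finite measure.\<close>

lemma L2_I01_integrable:
  assumes "L2 I01 f"
  shows "integrable I01 f"
proof (rule Bochner_Integration.integrable_bound[of _ "\<lambda>x. 1 + (norm (f x))\<^sup>2"])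
  have "norm y \<le> 1 + (norm y)\<^sup>2" for y :: "complex^'a"
  proof -
    have "2 * norm y \<le> 1 + (norm y)\<^sup>2" using sum_squares_bound[of 1 "norm y"] by simp
    then show ?thesis using norm_ge_zero[of y] by linarith
  qed
  then show "AE x in I01. norm (f x) \<le> norm (1 + (norm (f x))\<^sup>2)"
    by simp
qed (use assms in \<open>auto simp: L2_def\<close>)

text \<open>Represent both functions by primitives of their weak derivatives, up to constants.\<close>
lemma ipL2_integration_by_parts:
  fixes u v :: "real \<Rightarrow> complex^'n"
  assumes u: "integrable I01 u" "integrable I01 u'" "wder u u'"
    and v: "integrable I01 v" "integrable I01 v'" "wder v v'"
  shows "ipL2 I01 u' v + ipL2 I01 u v' = cdot (ev u 1) (ev v 1) - cdot (ev u 0) (ev v 0)"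
proof -
  interpret bounded_bilinear cdot by (rule bounded_bilinear_cdot)
  obtain c where c: "AE t in I01. u t = c + prim u' t" using wder_representation[OF u] .
  obtain d where d: "AE t in I01. v t = d + prim v' t" using wder_representation[OF v] .
  have cc: "continuous_on {0..1} (\<lambda>t. c + prim u' t)" "continuous_on {0..1} (\<lambda>t. d + prim v' t)"
    by (intro continuous_intros prim_continuous u v)+
  let ?A = "integral\<^sup>L I01 u'" and ?B = "integral\<^sup>L I01 v'"
  have m [measurable]: "u \<in> borel_measurable I01" "u' \<in> borel_measurable I01"
    "v \<in> borel_measurable I01" "v' \<in> borel_measurable I01"
    using u v by auto
  have pm [measurable]: "prim u' \<in> borel_measurable I01" "prim v' \<in> borel_measurable I01"
    by (intro continuous_on_imp_measurable_I01 prim_continuous u v)+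
  have cm: "(\<lambda>t. cdot (u' t) (v t)) \<in> borel_measurable I01" "(\<lambda>t. cdot (u t) (v' t)) \<in> borel_measurable I01"
    by (intro bounded_bilinear_measurable[OF bounded_bilinear_cdot] m)+
  have i: "integrable I01 (\<lambda>t. cdot (u' t) d)" "integrable I01 (\<lambda>t. cdot c (v' t))"
    "integrable I01 (\<lambda>t. cdot (u' t) (prim v' t))" "integrable I01 (\<lambda>t. cdot (prim u' t) (v' t))"
    using integrable_bounded_linear[OF bounded_linear_left u(2)] integrable_bounded_linear[OF bounded_linear_right v(2)]
      bounded_bilinear_integrable_continuous[OF bounded_bilinear.flip[OF bounded_bilinear_cdot] prim_continuous[OF v(2)] u(2)]
      bounded_bilinear_integrable_continuous[OF bounded_bilinear_cdot prim_continuous[OF u(2)] v(2)]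
    by auto
  have "ipL2 I01 u' v = integral\<^sup>L I01 (\<lambda>t. cdot (u' t) d + cdot (u' t) (prim v' t))"
    unfolding ipL2_def
  proof (rule integral_cong_AE)
    show "AE t in I01. cdot (u' t) (v t) = cdot (u' t) d + cdot (u' t) (prim v' t)"
      using d by eventually_elim (simp add: add_right)
  qed (use cm i in auto)
  also have "\<dots> = cdot ?A d + integral\<^sup>L I01 (\<lambda>t. cdot (u' t) (prim v' t))"
    using i integral_bounded_linear[OF bounded_linear_left u(2)] by simp
  finally have 1: "ipL2 I01 u' v = cdot ?A d + integral\<^sup>L I01 (\<lambda>t. cdot (u' t) (prim v' t))" .
  have "ipL2 I01 u v' = integral\<^sup>L I01 (\<lambda>t. cdot c (v' t) + cdot (prim u' t) (v' t))"
    unfolding ipL2_def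
  proof (rule integral_cong_AE)
    show "AE t in I01. cdot (u t) (v' t) = cdot c (v' t) + cdot (prim u' t) (v' t)"
      using c by eventually_elim (simp add: add_left)
  qed (use cm i in auto)
  also have "\<dots> = cdot c ?B + integral\<^sup>L I01 (\<lambda>t. cdot (prim u' t) (v' t))"
    using i integral_bounded_linear[OF bounded_linear_right v(2)] by simp
  finally have "ipL2 I01 u' v + ipL2 I01 u v' = cdot ?A d + cdot c ?B + cdot ?A ?B"
    using 1 prim_integration_by_parts[OF bounded_bilinear_cdot u(2) v(2)] by (simp add: algebra_simps)
  \<comment> \<open>The continuous representatives take the values \<open>c\<close> and
    \<open>d\<close> at 0, and \<open>c + ?A\<close> and \<open>d + ?B\<close> at 1.\<close>
  also have "\<dots> = cdot (c + ?A) (d + ?B) - cdot c d"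
    by (simp add: add_left add_right)
  finally show ?thesis
    by (simp add: ev_eq[OF cc(1) c] ev_eq[OF cc(2) d] prim_0 prim_1)
qed

lemma cdot_le:
  obtains K where "K > 0" "\<And>u v :: complex^'n. norm (cdot u v) \<le> norm u * norm v * K"
  using bounded_bilinear.pos_bounded[OF bounded_bilinear_cdot] by blast

lemma L2_cdot_integrable:
  fixes f g :: "'a \<Rightarrow> complex^'n"
  assumes f: "L2 M f" and g: "L2 M g"
  shows "integrable M (\<lambda>x. cdot (f x) (g x))"
proof -
  obtain K where K: "K > 0" "\<And>u v :: complex^'n. norm (cdot u v) \<le> norm u * norm v * K"
    using cdot_le by blast
  show ?thesis
  proof (rule Bochner_Integration.integrable_bound)
    show "integrable M (\<lambda>x. ((norm (f x))\<^sup>2 + (norm (g x))\<^sup>2) * K)"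
      using f g by (auto simp: L2_def)
    show "(\<lambda>x. cdot (f x) (g x)) \<in> borel_measurable M"
      using f g by (intro bounded_bilinear_measurable[OF bounded_bilinear_cdot]) (auto simp: L2_def)
    have "norm u * norm v \<le> (norm u)\<^sup>2 + (norm v)\<^sup>2" for u v :: "complex^'n"
      using sum_squares_bound[of "norm u" "norm v"] mult_nonneg_nonneg[OF norm_ge_zero[of u] norm_ge_zero[of v]]
      by linarith
    then have "norm (cdot u v) \<le> ((norm u)\<^sup>2 + (norm v)\<^sup>2) * K" for u v :: "complex^'n"
      using K(2)[of u v] K(1) by (meson mult_right_mono less_imp_le order_trans)
    then show "AE x in M. norm (cdot (f x) (g x)) \<le> norm (((norm (f x))\<^sup>2 + (norm (g x))\<^sup>2) * K)"
      by (intro AE_I2) (smt (verit) real_norm_def)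
  qed
qed

lemma L2_diff:
  fixes f g :: "'a \<Rightarrow> complex^'n"
  assumes f: "L2 M f" and g: "L2 M g"
  shows "L2 M (\<lambda>x. f x - g x)"
  unfolding L2_def
proof
  have [measurable]: "f \<in> borel_measurable M" "g \<in> borel_measurable M"
    using f g by (auto simp: L2_def)
  show "(\<lambda>x. f x - g x) \<in> borel_measurable M" by measurable
  show "integrable M (\<lambda>x. (norm (f x - g x))\<^sup>2)"
  proof (rule Bochner_Integration.integrable_bound)
    show "integrable M (\<lambda>x. 2 * (norm (f x))\<^sup>2 + 2 * (norm (g x))\<^sup>2)"
      using f g by (auto simp: L2_def)
    have "(norm (u - v))\<^sup>2 \<le> 2 * (norm u)\<^sup>2 + 2 * (norm v)\<^sup>2" for u v :: "complex^'n"
    proof -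
      have "(norm (u - v))\<^sup>2 \<le> (norm u + norm v)\<^sup>2"
        by (intro power_mono norm_triangle_ineq4) auto
      then show ?thesis
        using sum_squares_bound[of "norm u" "norm v"] by (simp add: power2_sum)
    qed
    then show "AE x in M. norm ((norm (f x - g x))\<^sup>2) \<le> norm (2 * (norm (f x))\<^sup>2 + 2 * (norm (g x))\<^sup>2)"
      by simp
  qed measurable
qed

lemma ipL2_diff_left:
  "L2 M f \<Longrightarrow> L2 M g \<Longrightarrow> L2 M h \<Longrightarrow> ipL2 M (\<lambda>x. f x - g x) h = ipL2 M f h - ipL2 M g h"
  unfolding ipL2_def
  by (simp add: bounded_bilinear.diff_left[OF bounded_bilinear_cdot] L2_cdot_integrable)

lemma ipL2_minus_left: "ipL2 M (\<lambda>x. - f x) h = - ipL2 M f h"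
  unfolding ipL2_def by (simp add: bounded_bilinear.minus_left[OF bounded_bilinear_cdot])

lemma ipL2_minus_right: "ipL2 M f (\<lambda>x. - h x) = - ipL2 M f h"
  unfolding ipL2_def by (simp add: bounded_bilinear.minus_right[OF bounded_bilinear_cdot])

text \<open>In place of Cauchy-Schwarz, the weighted inequality
  \<open>a b \<le> a^2 / \<delta> + \<delta> b^2\<close> is integrated: \<delta> makes the term in
  \<open>g\<close> small, after which the term in \<open>fs n - f\<close> tends to zero.\<close>

lemma ipL2_tendsto:
  fixes f g :: "'a \<Rightarrow> complex^'n"
  assumes fs: "\<And>n. L2 M (fs n)" and f: "L2 M f" and g: "L2 M g" and conv: "L2conv M fs f"
  shows "(\<lambda>n. ipL2 M (fs n) g) \<longlonglongrightarrow> ipL2 M f g"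
proof (rule LIMSEQ_I)
  fix e :: real assume "e > 0"
  obtain K where K: "K > 0" "\<And>u v :: complex^'n. norm (cdot u v) \<le> norm u * norm v * K"
    using cdot_le by blast
  define G where "G = integral\<^sup>L M (\<lambda>x. (norm (g x))\<^sup>2)"
  have "G \<ge> 0" by (simp add: G_def)
  \<comment> \<open>Using \<open>G + 1\<close> keeps the denominator positive even if
    \<open>g\<close> vanishes, and it makes \<open>K * \<delta> * G\<close> smaller than
    \<open>e / 2\<close>.\<close>
  define \<delta> where "\<delta> = e / (2 * K * (G + 1))"
  have "\<delta> > 0" using \<open>e > 0\<close> K(1) \<open>G \<ge> 0\<close> by (simp add: \<delta>_def)
  have "K * \<delta> * G < K * \<delta> * (G + 1)"
    using \<open>\<delta> > 0\<close> K(1) by simp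
  also have "\<dots> = e / 2"
    using K(1) \<open>G \<ge> 0\<close> by (simp add: \<delta>_def divide_simps)
  finally have \<delta>: "K * \<delta> * G < e / 2" .
  have bound: "norm (ipL2 M (fs n) g - ipL2 M f g)
      \<le> K / \<delta> * integral\<^sup>L M (\<lambda>x. (norm (fs n x - f x))\<^sup>2) + K * \<delta> * G" for n
  proof -
    have d: "L2 M (\<lambda>x. fs n x - f x)" by (rule L2_diff[OF fs f])
    have "norm (ipL2 M (fs n) g - ipL2 M f g) = norm (integral\<^sup>L M (\<lambda>x. cdot (fs n x - f x) (g x)))"
      using ipL2_diff_left[OF fs f g] by (simp add: ipL2_def)
    also have "\<dots> \<le> integral\<^sup>L M (\<lambda>x. norm (cdot (fs n x - f x) (g x)))"
      by (rule integral_norm_bound)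
    also have "\<dots> \<le> integral\<^sup>L M (\<lambda>x. K / \<delta> * (norm (fs n x - f x))\<^sup>2 + K * \<delta> * (norm (g x))\<^sup>2)"
    proof (rule integral_mono)
      show "integrable M (\<lambda>x. norm (cdot (fs n x - f x) (g x)))"
        by (intro integrable_norm L2_cdot_integrable d g)
      show "integrable M (\<lambda>x. K / \<delta> * (norm (fs n x - f x))\<^sup>2 + K * \<delta> * (norm (g x))\<^sup>2)"
        using d g by (auto simp: L2_def)
      fix x
      have "a * b \<le> a\<^sup>2 / \<delta> + \<delta> * b\<^sup>2" if "a \<ge> 0" "b \<ge> 0" for a b :: real
      proof -
        have "2 * (a / sqrt \<delta>) * (sqrt \<delta> * b) \<le> (a / sqrt \<delta>)\<^sup>2 + (sqrt \<delta> * b)\<^sup>2"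
          by (rule sum_squares_bound)
        then have "2 * (a * b) \<le> a\<^sup>2 / \<delta> + \<delta> * b\<^sup>2"
          using \<open>\<delta> > 0\<close> by (simp add: power_divide power_mult_distrib)
        then show ?thesis using mult_nonneg_nonneg[OF that] by linarith
      qed
      from mult_right_mono[OF this[OF norm_ge_zero[of "fs n x - f x"] norm_ge_zero[of "g x"]] less_imp_le[OF K(1)]]
      show "norm (cdot (fs n x - f x) (g x)) \<le> K / \<delta> * (norm (fs n x - f x))\<^sup>2 + K * \<delta> * (norm (g x))\<^sup>2"
        using K(2)[of "fs n x - f x" "g x"] by (simp add: algebra_simps)
    qed
    also have "\<dots> = K / \<delta> * integral\<^sup>L M (\<lambda>x. (norm (fs n x - f x))\<^sup>2) + K * \<delta> * G"
      using d g by (simp add: L2_def G_def)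
    finally show ?thesis .
  qed
  have "(\<lambda>n. K / \<delta> * integral\<^sup>L M (\<lambda>x. (norm (fs n x - f x))\<^sup>2)) \<longlonglongrightarrow> K / \<delta> * 0"
    using conv unfolding L2conv_def by (rule tendsto_mult_left)
  then have "\<forall>\<^sub>F n in sequentially. K / \<delta> * integral\<^sup>L M (\<lambda>x. (norm (fs n x - f x))\<^sup>2) < e / 2"
    by (rule order_tendstoD) (use \<open>e > 0\<close> in simp)
  then have "\<forall>\<^sub>F n in sequentially. norm (ipL2 M (fs n) g - ipL2 M f g) < e"
  proof eventually_elim
    case (elim n)
    then show ?case using bound[of n] \<delta> by linarith
  qed
  then show "\<exists>no. \<forall>n\<ge>no. norm (ipL2 M (fs n) g - ipL2 M f g) < e"
    by (simp add: eventually_sequentially)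
qed

subsection \<open>Green identities for the two operators\<close>

lemma continuous_compact_support_L2:
  fixes f :: "pt \<Rightarrow> complex^'n"
  assumes c: "continuous_on UNIV f" and K: "compact K" and supp: "\<And>x. x \<notin> K \<Longrightarrow> f x = 0"
    and S: "S \<in> sets lebesgue"
  shows "L2 (lebesgue_on S) f"
  unfolding L2_def
proof
  have fb: "f \<in> borel_measurable borel"
    using c by (rule borel_measurable_continuous_onI)
  then show "f \<in> borel_measurable (lebesgue_on S)"
    by (simp add: measurable_completion measurable_restrict_space1)
  have "integrable lborel (\<lambda>x. indicator K x *\<^sub>R (norm (f x))\<^sup>2)"
    by (rule borel_integrable_compact[OF K])
      (intro continuous_intros continuous_on_subset[OF c], simp)
  also have "(\<lambda>x. indicator K x *\<^sub>R (norm (f x))\<^sup>2) = (\<lambda>x. (norm (f x))\<^sup>2)"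
    using supp by (fastforce split: split_indicator)
  finally have "integrable lebesgue (\<lambda>x. (norm (f x))\<^sup>2)"
    using fb by (subst integrable_completion) auto
  then show "integrable (lebesgue_on S) (\<lambda>x. (norm (f x))\<^sup>2)"
    using S integrable_mult_indicator[OF S, of "\<lambda>x. (norm (f x))\<^sup>2"]
    by (subst integrable_restrict_space) auto
qed

lemma pd_zero_outside_support:
  assumes "x \<notin> closure {x. f x \<noteq> 0}"
  shows "pd j f x = 0"
proof -
  have "((\<lambda>x. 0) has_derivative (\<lambda>h. 0)) (at x)" by simp
  then have "(f has_derivative (\<lambda>h. 0)) (at x)"
    by (rule has_derivative_transform_within_open[where s="- closure {x. f x \<noteq> 0}"])
      (use assms closure_subset[of "{x. f x \<noteq> 0}"] in \<open>auto simp: open_Compl\<close>)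
  then show ?thesis
    unfolding pd_def by (simp add: frechet_derivative_at[symmetric])
qed

text \<open>\<open>A1B\<close> records only smoothness and compact support of the field; the square
  integrability of the field and its curl, used in passing to the closure, comes from here. Partial
  derivatives vanish off the closed support, so the curl has compact support too.\<close>

lemma Cc_inf_L2:
  assumes H: "Cc_inf H" and S: "S \<in> sets lebesgue"
  shows "L2 (lebesgue_on S) H" "L2 (lebesgue_on S) (rotc H)"
proof -
  have d: "dpart js H differentiable (at x)" for js x
    using H by (simp add: Cc_inf_def Cinf_def)
  have cont: "continuous_on UNIV (dpart js H)" for js
    using d by (auto intro!: continuous_at_imp_continuous_on differentiable_imp_continuous_within)
  have K: "compact (closure {x. H x \<noteq> 0})"
    using H by (simp add: Cc_inf_def)
  show "L2 (lebesgue_on S) H"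
    using closure_subset[of "{x. H x \<noteq> 0}"]
    by (intro continuous_compact_support_L2[OF _ K _ S]) (use cont[of "[]"] in auto)
  have cpd: "continuous_on UNIV (pd j H)" for j
    using cont[of "[j]"] by simp
  show "L2 (lebesgue_on S) (rotc H)"
  proof (rule continuous_compact_support_L2[OF _ K _ S])
    show "continuous_on UNIV (rotc H)"
      unfolding rotc_def
    proof (rule continuous_on_vec_lambda)
      fix j :: 3
      show "continuous_on UNIV (\<lambda>x. if j = 1 then pd 2 H x $ 3 - pd 3 H x $ 2
                else if j = 2 then pd 3 H x $ 1 - pd 1 H x $ 3
                else pd 1 H x $ 2 - pd 2 H x $ 1)"
        by (cases "j = 1"; cases "j = 2") (auto intro!: continuous_intros cpd)
    qed
    show "rotc H x = 0" if "x \<notin> closure {x. H x \<noteq> 0}" for x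
      using pd_zero_outside_support[OF that] by (simp add: rotc_def vec_eq_iff)
  qed
qed

text \<open>The index type is finite, so a closed set is removed from an open one.\<close>

lemma Omega_lebesgue:
  fixes r :: "'k::finite \<Rightarrow> real"
  assumes "lipschitz_domain \<Omega>0"
  shows "Omega \<Omega>0 r \<alpha> \<kappa>1 \<kappa>2 \<in> sets lebesgue"
proof -
  have "open (Omega \<Omega>0 r \<alpha> \<kappa>1 \<kappa>2)"
    unfolding Omega_def using assms
    by (intro open_Diff closed_UN) (auto simp: lipschitz_domain_def)
  then show ?thesis by (simp add: lborelD)
qed

section \<open>Conjugate symmetry and signs of the pairings\<close>

lemma cnj_spair: "cnj (spair r \<alpha> \<kappa>1 \<kappa>2 F G) = spair r \<alpha> \<kappa>1 \<kappa>2 G F"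
  unfolding spair_def cnj_sum Bochner_Integration.integral_cnj[symmetric]
  by (simp add: case_prod_unfold cnj_cdot)

lemma cdot_minus: "cdot (- u) v = - cdot u v" "cdot u (- v) = - cdot u v"
  using bounded_bilinear.minus_left[OF bounded_bilinear_cdot] bounded_bilinear.minus_right[OF bounded_bilinear_cdot]
  by auto

lemma cnj_ip2k: "cnj (ip2k a b) = ip2k b a"
  by (simp add: ip2k_def cnj_cdot)

lemma cnj_ipX1: "cnj (ipX1 \<Omega> a b) = ipX1 \<Omega> b a"
  by (simp add: ipX1_def cnj_ipL2)

lemma wder_minus: "wder u w \<Longrightarrow> wder (\<lambda>t. - u t) (\<lambda>t. - w t)"
  by (simp add: wder_def)

lemma A1B_A2_green:
  fixes r :: "'k::finite \<Rightarrow> real"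
  assumes A1: "A1B \<Omega>0 r \<alpha> \<kappa>1 \<kappa>2 IH YZ b" and A2: "A2 \<Omega>0 r \<alpha> \<kappa>1 \<kappa>2 VE PQ"
  defines "\<Omega> \<equiv> Omega \<Omega>0 r \<alpha> \<kappa>1 \<kappa>2"
  shows "ipX1 \<Omega> YZ VE + ipX1 \<Omega> IH PQ = ip2k b (B2 (fst VE))"
proof -
  obtain I H Y Z V E P Q where eqs: "IH = (I, H)" "YZ = (Y, Z)" "VE = (V, E)" "PQ = (P, Q)"
    by (metis surj_pair)
  from A1 obtain w where I: "L2 I01 I" and H: "Cc_inf H"
    and w: "L2 I01 w" "\<And>h. L2 I01 h \<Longrightarrow> ipL2 I01 w h
        = spair r \<alpha> \<kappa>1 \<kappa>2 (gx r \<alpha> \<kappa>1 \<kappa>2 H) (Pel r \<alpha> \<kappa>1 \<kappa>2 h)"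
    and Y: "L2 I01 Y" "wder (\<lambda>t. w t - I t) Y"
    and b: "b = (ev (\<lambda>t. I t - w t) 0, ev (\<lambda>t. I t - w t) 1)" and Z: "Z = rotc H"
    by (auto simp: A1B_def eqs Let_def H1_def is_Padj_def)
  from A2 obtain V' F where V: "L2 I01 V" "L2 I01 V'" "wder V V'"
    and green: "ipL2 (lebesgue_on \<Omega>) E (rotc H) - ipL2 (lebesgue_on \<Omega>) F H =
           spair r \<alpha> \<kappa>1 \<kappa>2 (Pel r \<alpha> \<kappa>1 \<kappa>2 V') (gx r \<alpha> \<kappa>1 \<kappa>2 H)"
    and P: "P = (\<lambda>t. - V' t)" and Q: "Q = (\<lambda>x. - F x)"
    using H unfolding A2_def eqs Let_def \<Omega>_def by auto
  let ?u = "\<lambda>t. I t - w t"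
  have u: "L2 I01 ?u" by (rule L2_diff[OF I w(1)])
  \<comment> \<open>In \<open>A1B\<close> the first component \<open>Y\<close> is the weak
    derivative of \<open>w - I\<close>, the negative of the total current \<open>?u\<close>.\<close>
  have Y': "wder ?u (\<lambda>t. - Y t)"
    using wder_minus[OF Y(2)] by simp
  \<comment> \<open>Conjugation moves the trace of \<open>H\<close> into the first slot of the
    surface pairing, where the adjoint relation for \<open>w\<close> can be used with
    \<open>V'\<close>.\<close>
  have "cnj (ipL2 (lebesgue_on \<Omega>) E (rotc H) - ipL2 (lebesgue_on \<Omega>) F H) = ipL2 I01 w V'"
    unfolding green cnj_spair w(2)[OF V(2)] ..
  then have 1: "ipL2 (lebesgue_on \<Omega>) (rotc H) E - ipL2 (lebesgue_on \<Omega>) H F = ipL2 I01 w V'"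
    by (simp add: cnj_ipL2)
  have 2: "ipL2 I01 (\<lambda>t. - Y t) V + ipL2 I01 ?u V' = cdot (ev ?u 1) (ev V 1) - cdot (ev ?u 0) (ev V 0)"
    using L2_I01_integrable[OF Y(1)]
    by (intro ipL2_integration_by_parts L2_I01_integrable[OF u] Y' L2_I01_integrable[OF V(1)]
        L2_I01_integrable[OF V(2)] V(3)) simp
  have 3: "ipL2 I01 ?u V' = ipL2 I01 I V' - ipL2 I01 w V'"
    by (rule ipL2_diff_left[OF I w(1) V(2)])
  show ?thesis
    \<comment> \<open>The term \<open>ipL2 I01 w V'\<close> from the curl identity combines with
      \<open>I\<close> into \<open>?u\<close>; the minus sign in \<open>B2\<close> matches the sign
      of the boundary term at 1.\<close>
    using 1 2 3
    by (simp add: eqs ipX1_def ip2k_def B2_def b Z P Q ipL2_minus_left ipL2_minus_right cdot_minus algebra_simps)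
qed

lemma ip2k_tendsto: "bs \<longlonglongrightarrow> b \<Longrightarrow> (\<lambda>n. ip2k (bs n) c) \<longlonglongrightarrow> ip2k b c"
  unfolding ip2k_def
  by (intro tendsto_intros bounded_bilinear.tendsto[OF bounded_bilinear_cdot])

text \<open>\<open>VE\<close> and \<open>PQ\<close> stay fixed while the other element is
  approximated, so continuity of the pairings in the left slot is enough; the boundary values
  converge by the definition of \<open>A1barB\<close>.\<close>

lemma A1barB_A2_green:
  fixes r :: "'k::finite \<Rightarrow> real"
  assumes lip: "lipschitz_domain \<Omega>0"
    and A1: "A1barB \<Omega>0 r \<alpha> \<kappa>1 \<kappa>2 IH YZ b" and A2: "A2 \<Omega>0 r \<alpha> \<kappa>1 \<kappa>2 VE PQ"
  defines "\<Omega> \<equiv> Omega \<Omega>0 r \<alpha> \<kappa>1 \<kappa>2"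
  shows "ipX1 \<Omega> YZ VE + ipX1 \<Omega> IH PQ = ip2k b (B2 (fst VE))"
proof -
  from A1 obtain IHs YZs bs where L2s: "L2 I01 (fst IH)" "L2 (lebesgue_on \<Omega>) (snd IH)"
      "L2 I01 (fst YZ)" "L2 (lebesgue_on \<Omega>) (snd YZ)"
    and A1n: "\<And>n. A1B \<Omega>0 r \<alpha> \<kappa>1 \<kappa>2 (IHs n) (YZs n) (bs n)"
    and conv: "L2conv I01 (\<lambda>n. fst (IHs n)) (fst IH)"
      "L2conv (lebesgue_on \<Omega>) (\<lambda>n. snd (IHs n)) (snd IH)"
      "L2conv I01 (\<lambda>n. fst (YZs n)) (fst YZ)"
      "L2conv (lebesgue_on \<Omega>) (\<lambda>n. snd (YZs n)) (snd YZ)"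
    and b: "bs \<longlonglongrightarrow> b"
    unfolding A1barB_def Let_def \<Omega>_def by blast
  have VE: "L2 I01 (fst VE)" "L2 (lebesgue_on \<Omega>) (snd VE)"
    and PQ: "L2 I01 (fst PQ)" "L2 (lebesgue_on \<Omega>) (snd PQ)"
    using A2 unfolding A2_def HGr_def Let_def \<Omega>_def by (auto simp: L2_def)
  have \<Omega>: "\<Omega> \<in> sets lebesgue"
    unfolding \<Omega>_def by (rule Omega_lebesgue[OF lip])
  have n: "L2 I01 (fst (IHs n))" "L2 (lebesgue_on \<Omega>) (snd (IHs n))"
      "L2 I01 (fst (YZs n))" "L2 (lebesgue_on \<Omega>) (snd (YZs n))" for n
  proof -
    have H: "Cc_inf (snd (IHs n))" and Z: "snd (YZs n) = rotc (snd (IHs n))"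
      and IY: "L2 I01 (fst (IHs n))" "L2 I01 (fst (YZs n))"
      using A1n[of n] by (auto simp: A1B_def Let_def H1_def)
    show "L2 I01 (fst (IHs n))" "L2 (lebesgue_on \<Omega>) (snd (IHs n))"
      "L2 I01 (fst (YZs n))" "L2 (lebesgue_on \<Omega>) (snd (YZs n))"
      using IY Cc_inf_L2[OF H \<Omega>] by (auto simp: Z)
  qed
  have "(\<lambda>n. ipX1 \<Omega> (YZs n) VE + ipX1 \<Omega> (IHs n) PQ) \<longlonglongrightarrow> ipX1 \<Omega> YZ VE + ipX1 \<Omega> IH PQ"
    unfolding ipX1_def
    by (intro tendsto_add ipL2_tendsto n conv L2s VE PQ)
  moreover have "(\<lambda>n. ipX1 \<Omega> (YZs n) VE + ipX1 \<Omega> (IHs n) PQ) = (\<lambda>n. ip2k (bs n) (B2 (fst VE)))"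
    unfolding \<Omega>_def by (intro ext A1B_A2_green A1n A2)
  ultimately show ?thesis
    using ip2k_tendsto[OF b, of "B2 (fst VE)"] LIMSEQ_unique by metis
qed

text \<open>Operators enter through their graphs: \<open>(Yj, Zj)\<close> and \<open>bj\<close> are
  the values of the closure of \<open>A\<^sub>1\<close> and of the extended first boundary map at
  \<open>(Ij, Hj)\<close>, and \<open>(Pj, Qj)\<close> is the value of \<open>A\<^sub>2\<close> at
  \<open>(Vj, Ej)\<close>. The block operator exchanges the two pairs, which explains who is paired
  with whom.\<close>

theorem mainTheorem9:
  fixes \<Omega>0 :: "(real^3) set"
    and r l :: "'k::finite \<Rightarrow> real"
    and \<alpha> \<kappa>1 \<kappa>2 :: "'k \<Rightarrow> real \<Rightarrow> real^3"
    and I1 I2 V1 V2 Y1 Y2 P1 P2 :: "real \<Rightarrow> complex^'k"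
    and H1 H2 E1 E2 Z1 Z2 Q1 Q2 :: "real^3 \<Rightarrow> complex^3"
    and b1 b2 :: "(complex^'k) \<times> (complex^'k)"
  assumes lip: "lipschitz_domain \<Omega>0"
    and r_pos: "\<forall>i. r i > 0" and l_pos: "\<forall>i. l i > 0"
    and \<alpha>_C2: "\<forall>i. C2_01 (\<alpha> i)"
    and \<alpha>_speed: "\<forall>i. \<forall>\<eta>\<in>{0..1}. norm (vd (\<alpha> i) \<eta>) = l i"
    and \<alpha>_curv: "\<forall>i. \<forall>\<eta>\<in>{0..1}. norm (vd (vd (\<alpha> i)) \<eta>) < (l i)\<^sup>2 / r i"
    and \<kappa>_C1: "\<forall>i. C1_01 (\<kappa>1 i) \<and> C1_01 (\<kappa>2 i)"
    and frame: "\<forall>i. \<forall>\<eta>\<in>{0..1}. pos_onb ((1 / l i) *\<^sub>R vd (\<alpha> i) \<eta>) (\<kappa>1 i \<eta>) (\<kappa>2 i \<eta>)"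
    and inside: "\<forall>i. closure (tube r \<alpha> \<kappa>1 \<kappa>2 i) \<subseteq> \<Omega>0"
    and disj: "\<forall>i j. i \<noteq> j \<longrightarrow> closure (tube r \<alpha> \<kappa>1 \<kappa>2 i) \<inter> closure (tube r \<alpha> \<kappa>1 \<kappa>2 j) = {}"
    and e1_A1: "A1barB \<Omega>0 r \<alpha> \<kappa>1 \<kappa>2 (I1, H1) (Y1, Z1) b1"
    and e1_A2: "A2 \<Omega>0 r \<alpha> \<kappa>1 \<kappa>2 (V1, E1) (P1, Q1)"
    and e2_A1: "A1barB \<Omega>0 r \<alpha> \<kappa>1 \<kappa>2 (I2, H2) (Y2, Z2) b2"
    and e2_A2: "A2 \<Omega>0 r \<alpha> \<kappa>1 \<kappa>2 (V2, E2) (P2, Q2)"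
  shows "(let \<Omega> = Omega \<Omega>0 r \<alpha> \<kappa>1 \<kappa>2 in
            (ipX1 \<Omega> (P1, Q1) (I2, H2) + ipX1 \<Omega> (Y1, Z1) (V2, E2))
          + (ipX1 \<Omega> (I1, H1) (P2, Q2) + ipX1 \<Omega> (V1, E1) (Y2, Z2)))
       = ip2k b1 (B2 V2) + ip2k (B2 V1) b2"
proof -
  let ?\<Omega> = "Omega \<Omega>0 r \<alpha> \<kappa>1 \<kappa>2"
  have 1: "ipX1 ?\<Omega> (Y1, Z1) (V2, E2) + ipX1 ?\<Omega> (I1, H1) (P2, Q2) = ip2k b1 (B2 V2)"
    using A1barB_A2_green[OF lip e1_A1 e2_A2] by simp
  have "cnj (ipX1 ?\<Omega> (Y2, Z2) (V1, E1) + ipX1 ?\<Omega> (I2, H2) (P1, Q1)) = cnj (ip2k b2 (B2 V1))"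
    using A1barB_A2_green[OF lip e2_A1 e1_A2] by simp
  then have 2: "ipX1 ?\<Omega> (V1, E1) (Y2, Z2) + ipX1 ?\<Omega> (P1, Q1) (I2, H2) = ip2k (B2 V1) b2"
    by (simp add: cnj_ipX1 cnj_ip2k)
  show ?thesis
    unfolding Let_def 1[symmetric] 2[symmetric] by (simp only: ac_simps)
qed

end
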